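(* Let $\Omega \subseteq \mathbb{H}$ be a symmetric slice domain and let $S=\{x_{\alpha}+y_{\alpha}\mathbb{S}\}_{\alpha\in A}$ (with $x_\alpha,y_\alpha\in\mathbb{R}$) be a closed and discrete set of two-dimensional spheres (or real points, when $y_\alpha=0$) contained in $\Omega$. For every $\alpha \in A$ let $q_\alpha=x_\alpha+y_\alpha I$, with $I\in\mathbb{S}$ any imaginary unit, let $m(\alpha) \in \mathbb{N}$, and let $$P_{\alpha}(q)=\sum_{n=1}^{m(\alpha)}\big((q-x_\alpha)^2+y_\alpha^2\big)^{-n}\big[A_{2n}^{(\alpha)}+(q-q_\alpha)A_{2n+1}^{(\alpha)}\big]$$ with $A_j^{(\alpha)}\in \mathbb{H}$ for all $j=2,\ldots,2m(\alpha)+1$. Then there exists a function $f$ semiregular on $\Omega$ such that for every $\alpha \in A$ the principal part of $f$ at $x_\alpha+y_\alpha\mathbb{S}$ is $P_{\alpha}$, and such that $f$ does not have other poles in $\Omega$.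
   Context: $\mathbb{H}$ is the real algebra of quaternions with its Euclidean topology, and $\mathbb{S}=\{q\in\mathbb{H}: q^2=-1\}$ is the 2-sphere of imaginary units. For $x,y\in\mathbb{R}$, $x+y\mathbb{S}=\{x+yJ: J\in\mathbb{S}\}$ (a 2-sphere if $y\neq 0$, the single real point $x$ if $y=0$). For $I\in\mathbb{S}$, $L_I=\mathbb{R}+I\mathbb{R}\simeq\mathbb{C}$; for $\Omega\subseteq\mathbb{H}$, $\Omega_I=\Omega\cap L_I$ and $f_I=f|_{\Omega_I}$. Domains: A domain $\Omega\subseteq\mathbb{H}$ (connected open set) is (axially) symmetric if $\Omega=\bigcup_{x+Iy\in\Omega}(x+y\mathbb{S})$. It is a slice domain if it intersects the real axis and $\Omega_I$ is a domain in $L_I$ for every $I\in\mathbb{S}$. A symmetric slice domain is one that is both. Closed and discrete set of spheres: the spheres (or real points) of $S$ are contained in $\Omega$, and closedness and discreteness are understood in $\Omega$, i.e. the spheres do not accumulate at any point of $\Omega$ (every compact subset of $\Omega$ meets only finitely many of them). Distinct indices $\alpha$ correspond to distinct spheres or real points. Regular functions: $f:\Omega\to\mathbb{H}$ is (slice) regular if for every $I\in\mathbb{S}$ the restriction $f_I$ is holomorphic, i.e. $\frac12\left(\frac{\partial}{\partial x}+I\frac{\partial}{\partial y}\right)f_I(x+Iy)=0$ on $\Omega_I$. Singularities and poles: A point $p=x+yI_p$ is a singularity of a regular function $f$ if, for some $R>0$, $f$ has a Laurent expansion $f(z)=\sum_{n\in\mathbb{Z}}(z-p)^n a_n$ ($a_n\in\mathbb{H}$)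 converging for $z\in L_{I_p}$ with $0<|z-p|<R$. It is a removable singularity if $f$ extends to a neighborhood of $p$ in $\mathbb{H}$ as a regular function. Otherwise, $p$ is a pole if there exists $m\ge 0$ with $a_{-k}=0$ for all $k>m$. Semiregular functions: $f$ is semiregular in (or on) a symmetric slice domain $\Omega$ if it is regular in a symmetric slice domain $\Omega'\subseteq\Omega$ such that every point of $\Omega\setminus\Omega'$ is a pole or a removable singularity of $f$. The nonremovable poles of $f$ form a set of isolated real points or isolated 2-spheres $x+y\mathbb{S}$. Principal part: If $f$ is semiregular on $\Omega$ with a pole at $x_0+y_0\mathbb{S}\subset\Omega$, then (known fact) there are $k\in\mathbb{N}$ and a unique semiregular $g$ on $\Omega$, regular on a symmetric slice neighborhood of $x_0+y_0\mathbb{S}$, with $f(q)=((q-x_0)^2+y_0^2)^{-k}g(q)$. For any fixed $q_0\in x_0+y_0\mathbb{S}$, $g$ has a spherical expansion $g(q)=\sum_{j\ge0}((q-x_0)^2+y_0^2)^j[B_{2j}+(q-q_0)B_{2j+1}]$, $B_j\in\mathbb{H}$, valid on some $U(x_0+y_0\mathbb{S},R)=\{q\in\mathbb{H}:|(q-x_0)^2+y_0^2|<R^2\}$, $R>0$. The resulting expansion $f(q)=\sum_{n\ge -k}((q-x_0)^2+y_0^2)^{n}[B_{2(n+k)}+(q-q_0)B_{2(n+k)+1}]$ on $U(x_0+y_0\mathbb{S},R)\setminus(x_0+y_0\mathbb{S})$ is the spherical Laurent series of $f$, and the principal part of $f$ at $x_0+y_0\mathbb{S}$ is the sum of its terms with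 negative exponent: $$P_{x_0+y_0\mathbb{S}}(q)=\sum_{n=1}^{k}((q-x_0)^2+y_0^2)^{-n}[B_{2(k-n)}+(q-q_0)B_{2(k-n)+1}].$$ In the theorem, the expansion at $x_\alpha+y_\alpha\mathbb{S}$ is taken with $q_0=q_\alpha$. If $f$ is regular (after extension) near $x_0+y_0\mathbb{S}$, its principal part there is $0$. *)

theory Defs
  imports "HOL-Analysis.Analysis"
begin

section \<open>The quaternions\<close>

codatatype quat = Quat (qRe: real) (qIm1: real) (qIm2: real) (qIm3: real)

lemma quat_eqI:
  "qRe p = qRe q \<Longrightarrow> qIm1 p = qIm1 q \<Longrightarrow> qIm2 p = qIm2 q \<Longrightarrow> qIm3 p = qIm3 q \<Longrightarrow> p = q"
  by (rule quat.expand) simp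

lemma quat_eq_iff:
  "p = q \<longleftrightarrow> qRe p = qRe q \<and> qIm1 p = qIm1 q \<and> qIm2 p = qIm2 q \<and> qIm3 p = qIm3 q"
  by (auto intro: quat_eqI)

instantiation quat :: ab_group_add
begin

primcorec zero_quat where
  "qRe 0 = 0" | "qIm1 0 = 0" | "qIm2 0 = 0" | "qIm3 0 = 0"

primcorec plus_quat where
  "qRe (p + q) = qRe p + qRe q"
| "qIm1 (p + q) = qIm1 p + qIm1 q"
| "qIm2 (p + q) = qIm2 p + qIm2 q"
| "qIm3 (p + q) = qIm3 p + qIm3 q"

primcorec uminus_quat where
  "qRe (- p) = - qRe p"
| "qIm1 (- p) = - qIm1 p"
| "qIm2 (- p) = - qIm2 p"
| "qIm3 (- p) = - qIm3 p"

primcorec minus_quat where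
  "qRe (p - q) = qRe p - qRe q"
| "qIm1 (p - q) = qIm1 p - qIm1 q"
| "qIm2 (p - q) = qIm2 p - qIm2 q"
| "qIm3 (p - q) = qIm3 p - qIm3 q"

instance
  by standard (simp_all add: quat_eq_iff)

end

instantiation quat :: real_vector
begin

primcorec scaleR_quat where
  "qRe (scaleR r q) = r * qRe q"
| "qIm1 (scaleR r q) = r * qIm1 q"
| "qIm2 (scaleR r q) = r * qIm2 q"
| "qIm3 (scaleR r q) = r * qIm3 q"

instance
  by standard (simp_all add: quat_eq_iff algebra_simps)

end

instantiation quat :: real_algebra_1
begin

primcorec one_quat where
  "qRe 1 = 1" | "qIm1 1 = 0" | "qIm2 1 = 0" | "qIm3 1 = 0"

primcorec times_quat where
  "qRe (p * q) = qRe p * qRe q - qIm1 p * qIm1 q - qIm2 p * qIm2 q - qIm3 p * qIm3 q"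
| "qIm1 (p * q) = qRe p * qIm1 q + qIm1 p * qRe q + qIm2 p * qIm3 q - qIm3 p * qIm2 q"
| "qIm2 (p * q) = qRe p * qIm2 q - qIm1 p * qIm3 q + qIm2 p * qRe q + qIm3 p * qIm1 q"
| "qIm3 (p * q) = qRe p * qIm3 q + qIm1 p * qIm2 q - qIm2 p * qIm1 q + qIm3 p * qRe q"

instance
  by standard (simp_all add: quat_eq_iff algebra_simps)

end

instantiation quat :: real_inner
begin

definition inner_quat :: "quat \<Rightarrow> quat \<Rightarrow> real" where
  "inner_quat p q = qRe p * qRe q + qIm1 p * qIm1 q + qIm2 p * qIm2 q + qIm3 p * qIm3 q"

definition norm_quat :: "quat \<Rightarrow> real" where
  "norm_quat q = sqrt (inner q q)"

definition sgn_quat :: "quat \<Rightarrow> quat" where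
  "sgn_quat q = q /\<^sub>R norm q"

definition dist_quat :: "quat \<Rightarrow> quat \<Rightarrow> real" where
  "dist_quat p q = norm (p - q)"

definition uniformity_quat :: "(quat \<times> quat) filter" where
  "uniformity_quat = (INF e\<in>{0<..}. principal {(p, q). dist p q < e})"

definition open_quat :: "quat set \<Rightarrow> bool" where
  "open_quat U = (\<forall>p\<in>U. \<forall>\<^sub>F (p', q) in uniformity. p' = p \<longrightarrow> q \<in> U)"

instance
proof
  fix p q s :: quat and r :: real and U :: "quat set"
  show "dist p q = norm (p - q)" by (rule dist_quat_def)
  show "sgn p = p /\<^sub>R norm p" by (rule sgn_quat_def)
  show "uniformity = (INF e\<in>{0<..}. principal {(p :: quat, q). dist p q < e})"
    by (rule uniformity_quat_def)
  show "open U = (\<forall>p\<in>U. \<forall>\<^sub>F (p', q) in uniformity. p' = p \<longrightarrow> q \<in> U)"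
    by (rule open_quat_def)
  show "inner p q = inner q p" by (simp add: inner_quat_def mult.commute)
  show "inner (p + q) s = inner p s + inner q s" by (simp add: inner_quat_def algebra_simps)
  show "inner (r *\<^sub>R p) q = r * inner p q" by (simp add: inner_quat_def algebra_simps)
  show "0 \<le> inner p p" by (simp add: inner_quat_def)
  show "(inner p p = 0) = (p = 0)"
    by (simp add: inner_quat_def quat_eq_iff add_nonneg_eq_0_iff)
  show "norm p = sqrt (inner p p)" by (rule norm_quat_def)
qed

end

instantiation quat :: real_normed_div_algebra
begin

definition inverse_quat :: "quat \<Rightarrow> quat" where
  "inverse_quat q = Quat (qRe q) (- qIm1 q) (- qIm2 q) (- qIm3 q) /\<^sub>R inner q q"

definition divide_quat :: "quat \<Rightarrow> quat \<Rightarrow> quat" where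
  "divide_quat p q = p * inverse q"

instance
proof
  fix p q :: quat
  show "p div q = p * inverse q" by (rule divide_quat_def)
  show "inverse (0 :: quat) = 0" by (simp add: inverse_quat_def)
  show "norm (p * q) = norm p * norm q"
    unfolding norm_quat_def real_sqrt_mult [symmetric]
    by (rule arg_cong [where f = sqrt]) (simp add: inner_quat_def algebra_simps)
  assume "q \<noteq> 0"
  then have q: "inner q q \<noteq> 0" by simp
  let ?c = "Quat (qRe q) (- qIm1 q) (- qIm2 q) (- qIm3 q)"
  have "?c * q = inner q q *\<^sub>R 1" "q * ?c = inner q q *\<^sub>R 1"
    by (simp_all add: quat_eq_iff inner_quat_def algebra_simps)
  with q show "inverse q * q = 1" "q * inverse q = 1"
    by (simp_all add: inverse_quat_def)
qed

end

instantiation quat :: euclidean_space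
begin

definition Basis_quat :: "quat set" where
  "Basis_quat = {Quat 1 0 0 0, Quat 0 1 0 0, Quat 0 0 1 0, Quat 0 0 0 1}"

instance
proof
  fix u v q :: quat
  show "(Basis :: quat set) \<noteq> {}" "finite (Basis :: quat set)"
    by (simp_all add: Basis_quat_def)
  show "inner u v = (if u = v then 1 else 0)" if "u \<in> Basis" "v \<in> Basis"
    using that unfolding Basis_quat_def
    by (elim insertE emptyE) (simp_all add: inner_quat_def)
  show "(\<forall>u\<in>Basis. inner q u = 0) = (q = 0)"
    by (auto simp: Basis_quat_def inner_quat_def intro: quat_eqI)
qed

end

section \<open>Symmetric slice domains\<close>

definition imag_units :: "quat set" where
  "imag_units = {q. q\<^sup>2 = -1}"

definition qsphere :: "real \<Rightarrow> real \<Rightarrow> quat set" where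
  "qsphere x y = {of_real x + of_real y * J | J. J \<in> imag_units}"

definition slice_plane :: "quat \<Rightarrow> quat set" where
  "slice_plane I = {of_real x + I * of_real y | x y. True}"

definition axially_symmetric :: "quat set \<Rightarrow> bool" where
  "axially_symmetric \<Omega> \<longleftrightarrow>
     \<Omega> = \<Union> {qsphere x y | x y I. I \<in> imag_units \<and> of_real x + I * of_real y \<in> \<Omega>}"

definition slice_domain :: "quat set \<Rightarrow> bool" where
  "slice_domain \<Omega> \<longleftrightarrow> open \<Omega> \<and> connected \<Omega> \<and> \<Omega> \<inter> \<real> \<noteq> {} \<and>
     (\<forall>I\<in>imag_units. openin (top_of_set (slice_plane I)) (\<Omega> \<inter> slice_plane I)
                     \<and> connected (\<Omega> \<inter> slice_plane I))"

definition symmetric_slice_domain :: "quat set \<Rightarrow> bool" where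
  "symmetric_slice_domain \<Omega> \<longleftrightarrow> slice_domain \<Omega> \<and> axially_symmetric \<Omega>"

section \<open>Regular and semiregular functions\<close>

text \<open>
  A function with domain \<open>D\<close> is a total function together with the set \<open>D\<close>; its values
  outside \<open>D\<close> are irrelevant. Holomorphy of a restriction to a slice means real
  differentiability together with the Cauchy-Riemann equation. The predicate is meant for
  open \<open>D\<close>.
\<close>

definition slice_regular_on :: "quat set \<Rightarrow> (quat \<Rightarrow> quat) \<Rightarrow> bool" where
  "slice_regular_on D f \<longleftrightarrow>
     (\<forall>I\<in>imag_units. \<forall>x y. of_real x + I * of_real y \<in> D \<longrightarrow>
        (\<exists>f'. ((\<lambda>(s, t). f (of_real s + I * of_real t)) has_derivative f') (at (x, y)) \<and>
              (1/2) *\<^sub>R (f' (1, 0) + I * f' (0, 1)) = 0))"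

text \<open>
  The expansion of \<open>f\<close> at \<open>p\<close> along the slice \<open>slice_plane I\<close>, which is meant to contain \<open>p\<close>.
  Pointwise unconditional summability over the integers on a punctured disc is the same as
  convergence of the regular part and of the principal part there.
\<close>

definition laurent_expansion ::
    "quat set \<Rightarrow> (quat \<Rightarrow> quat) \<Rightarrow> quat \<Rightarrow> quat \<Rightarrow> real \<Rightarrow> (int \<Rightarrow> quat) \<Rightarrow> bool" where
  "laurent_expansion D f p I R a \<longleftrightarrow> R > 0 \<and>
     (\<forall>z\<in>slice_plane I. 0 < norm (z - p) \<and> norm (z - p) < R \<longrightarrow>
        z \<in> D \<and> ((\<lambda>n::int. (z - p) powi n * a n) has_sum f z) UNIV)"

text \<open>
  A non-real point lies on exactly one slice; a real point lies on all of them, and the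
  conditions below are imposed for each.
\<close>

definition singularity :: "quat set \<Rightarrow> (quat \<Rightarrow> quat) \<Rightarrow> quat \<Rightarrow> bool" where
  "singularity D f p \<longleftrightarrow>
     (\<forall>I\<in>imag_units. p \<in> slice_plane I \<longrightarrow> (\<exists>R a. laurent_expansion D f p I R a))"

definition removable_singularity :: "quat set \<Rightarrow> (quat \<Rightarrow> quat) \<Rightarrow> quat \<Rightarrow> bool" where
  "removable_singularity D f p \<longleftrightarrow> singularity D f p \<and>
     (\<exists>U g. open U \<and> p \<in> U \<and> slice_regular_on U g \<and> (\<forall>q\<in>U \<inter> D. g q = f q))"

text \<open>
  A pole can have order \<open>m = 0\<close>: the restriction of \<open>f\<close> to the slice of \<open>p\<close> may extend
  holomorphically although \<open>f\<close> does not extend regularly to a neighbourhood of \<open>p\<close>.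
\<close>

definition qpole :: "quat set \<Rightarrow> (quat \<Rightarrow> quat) \<Rightarrow> quat \<Rightarrow> bool" where
  "qpole D f p \<longleftrightarrow> \<not> removable_singularity D f p \<and>
     (\<forall>I\<in>imag_units. p \<in> slice_plane I \<longrightarrow>
        (\<exists>R a. laurent_expansion D f p I R a \<and> (\<exists>m::nat. \<forall>k>m. a (- int k) = 0)))"

text \<open>\<open>D\<close> is the symmetric slice domain on which \<open>f\<close> is regular.\<close>

definition semiregular_on :: "quat set \<Rightarrow> quat set \<Rightarrow> (quat \<Rightarrow> quat) \<Rightarrow> bool" where
  "semiregular_on \<Omega> D f \<longleftrightarrow> symmetric_slice_domain \<Omega> \<and> symmetric_slice_domain D \<and> D \<subseteq> \<Omega> \<and>
     slice_regular_on D f \<and> (\<forall>p\<in>\<Omega> - D. qpole D f p \<or> removable_singularity D f p)"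

section \<open>Spherical Laurent series and principal parts\<close>

definition sphere_poly :: "real \<Rightarrow> real \<Rightarrow> quat \<Rightarrow> quat" where
  "sphere_poly x y q = (q - of_real x)\<^sup>2 + (of_real y)\<^sup>2"

definition sphere_nbhd :: "real \<Rightarrow> real \<Rightarrow> real \<Rightarrow> quat set" where
  "sphere_nbhd x y R = {q. norm (sphere_poly x y q) < R\<^sup>2}"

definition spherical_expansion ::
    "(quat \<Rightarrow> quat) \<Rightarrow> real \<Rightarrow> real \<Rightarrow> quat \<Rightarrow> real \<Rightarrow> (nat \<Rightarrow> quat) \<Rightarrow> bool" where
  "spherical_expansion g x y q\<^sub>0 R B \<longleftrightarrow>
     (\<forall>q\<in>sphere_nbhd x y R.
        (\<lambda>j. sphere_poly x y q ^ j * (B (2 * j) + (q - q\<^sub>0) * B (2 * j + 1))) sums g q)"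

text \<open>
  \<open>P\<close> is the principal part at \<open>qsphere x y\<close> of the function \<open>f\<close>, semiregular on \<open>\<Omega>\<close> and
  regular on \<open>D\<close>. Here \<open>f = sphere_poly x y ^ (-k) * g\<close> with \<open>g\<close> semiregular on \<open>\<Omega>\<close> and
  regular on the symmetric slice neighbourhood \<open>E\<close> of \<open>qsphere x y\<close>. The case where \<open>f\<close>
  extends regularly to the sphere is covered by \<open>k = 0\<close>, where \<open>P = 0\<close>. Enlarging \<open>k\<close>
  only prepends vanishing coefficients to \<open>B\<close> and does not affect \<open>P\<close>.
\<close>

definition has_principal_part ::
    "quat set \<Rightarrow> quat set \<Rightarrow> (quat \<Rightarrow> quat) \<Rightarrow> real \<Rightarrow> real \<Rightarrow> quat \<Rightarrow> (quat \<Rightarrow> quat) \<Rightarrow> bool" where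
  "has_principal_part \<Omega> D f x y q\<^sub>0 P \<longleftrightarrow>
     (\<exists>(k::nat) g E R B.
        semiregular_on \<Omega> E g \<and> qsphere x y \<subseteq> E \<and>
        (\<forall>q\<in>D \<inter> E - qsphere x y. f q = sphere_poly x y q powi (- int k) * g q) \<and>
        R > 0 \<and> sphere_nbhd x y R \<subseteq> E \<and> spherical_expansion g x y q\<^sub>0 R B \<and>
        (\<forall>q. q \<notin> qsphere x y \<longrightarrow>
           P q = (\<Sum>n=1..k. sphere_poly x y q powi (- int n) *
                    (B (2 * (k - n)) + (q - q\<^sub>0) * B (2 * (k - n) + 1)))))"

section \<open>Closed and discrete sets of spheres\<close>

definition closed_discrete_spheres ::
    "quat set \<Rightarrow> 'a set \<Rightarrow> ('a \<Rightarrow> real) \<Rightarrow> ('a \<Rightarrow> real) \<Rightarrow> bool" where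
  "closed_discrete_spheres \<Omega> A x y \<longleftrightarrow>
     (\<forall>\<alpha>\<in>A. qsphere (x \<alpha>) (y \<alpha>) \<subseteq> \<Omega>) \<and>
     inj_on (\<lambda>\<alpha>. qsphere (x \<alpha>) (y \<alpha>)) A \<and>
     (\<forall>K. compact K \<and> K \<subseteq> \<Omega> \<longrightarrow> finite {\<alpha>\<in>A. qsphere (x \<alpha>) (y \<alpha>) \<inter> K \<noteq> {}})"

end

theory Submission
  imports Defs "HOL-Complex_Analysis.Complex_Analysis"
begin

text \<open>
  A symmetric slice domain is the rotation of a domain \<open>U\<close> of the complex plane that is invariant
  under conjugation. A family \<open>G b\<close> of holomorphic functions on such a domain, indexed by the
  real basis of the quaternions and commuting with conjugation, induces the regular function
  \<open>x + I * y \<mapsto> (\<Sum>b. (Re (G b z) + I * Im (G b z)) * b)\<close> with \<open>z = x + \<i> * y\<close>. The prescribed principal parts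
  are induced by rational functions with real coefficients, and a sphere corresponds to a pair of
  conjugate points, so the theorem reduces to the classical Mittag-Leffler theorem on \<open>U\<close>,
  symmetrized by averaging \<open>F z\<close> and \<open>cnj (F (cnj z))\<close>. That theorem holds without Runge's theorem:
  a pole \<open>z\<close> that is close to the complement of \<open>U\<close>, relative to \<open>1 / norm z\<close>, is compensated by a polynomial in
  \<open>1 / (v - w)\<close> with \<open>w\<close> the point of the complement closest to \<open>z\<close>, any other pole by a Taylor polynomial.
  Subtracting the prescribed principal part leaves a holomorphic function near the sphere, and
  its power series in \<open>(z - x)\<^sup>2 + y\<^sup>2\<close> gives the remaining terms of the spherical Laurent series.
\<close>

section \<open>Mittag-Leffler's theorem for open sets\<close>

lemma meromorphic_at_imp_quotient:
  assumes "f meromorphic_on {z}"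
  obtains m h where "h analytic_on {z}" "\<forall>\<^sub>F w in at z. f w = h w / (w - z) ^ m"
proof -
  obtain F where F: "(\<lambda>w. f (z + w)) has_laurent_expansion F"
    using assms unfolding meromorphic_on_def by auto
  \<comment> \<open>Dividing the Laurent series by its leading power leaves the power series
    \<open>p\<close>. A nonnegative exponent \<open>n\<close> is later absorbed into
    \<open>h\<close> with \<open>m = 0\<close>; a negative one gives the denominator.\<close>
  define n where "n = fls_subdegree F"
  define p where "p = fls_base_factor_to_fps F"
  have r: "fps_conv_radius p > 0"
    using F by (auto simp: has_laurent_expansion_def p_def fls_conv_radius_altdef)
  have "\<forall>\<^sub>F w in at 0. f (z + w) = eval_fps p w * w powi n"
    using F by (auto simp: has_laurent_expansion_def eval_fls_def p_def n_def elim!: eventually_mono)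
  then have ev: "\<forall>\<^sub>F w in at z. f w = eval_fps p (w - z) * (w - z) powi n"
    by (simp add: at_to_0' eventually_filtermap add.commute)
  have an: "(\<lambda>w. eval_fps p (w - z)) analytic_on {z}"
    using r by (intro analytic_intros) (auto simp: zero_ereal_def)
  show ?thesis
  proof (cases "n \<ge> 0")
    case True
    show ?thesis
    proof (rule that[of "\<lambda>w. eval_fps p (w - z) * (w - z) ^ nat n" 0])
      show "(\<lambda>w. eval_fps p (w - z) * (w - z) ^ nat n) analytic_on {z}"
        by (intro analytic_intros an)
      show "\<forall>\<^sub>F w in at z. f w = eval_fps p (w - z) * (w - z) ^ nat n / (w - z) ^ 0"
        using ev True by (auto simp: power_int_def elim!: eventually_mono)
    qed
  next
    case False
    show ?thesis
    proof (rule that[OF an, of "nat (-n)"])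
      show "\<forall>\<^sub>F w in at z. f w = eval_fps p (w - z) / (w - z) ^ nat (-n)"
        using ev False by (auto simp: power_int_def field_simps elim!: eventually_mono)
    qed
  qed
qed

text \<open>The polar terms are peeled off one at a time: subtracting the leading term
  \<open>g z / (w - z) ^ Suc m\<close> lowers the exponent of the denominator by one.\<close>

lemma meromorphic_at_principal_part:
  assumes "f meromorphic_on {z}"
  obtains p h where "h analytic_on {z}" "\<forall>\<^sub>F w in at z. f w = poly p (1 / (w - z)) + h w"
proof -
  obtain m g where g: "g analytic_on {z}" "\<forall>\<^sub>F w in at z. f w = g w / (w - z) ^ m"
    using meromorphic_at_imp_quotient[OF assms] .
  have "\<exists>p h. h analytic_on {z} \<and> (\<forall>\<^sub>F w in at z. g w / (w - z) ^ m = poly p (1 / (w - z)) + h w)"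
    using g(1)
  proof (induction m arbitrary: g)
    case 0
    then show ?case by (intro exI[of _ 0] exI[of _ g]) auto
  next
    case (Suc m)
    obtain U where U: "open U" "z \<in> U" "g holomorphic_on U"
      using Suc.prems by (auto simp: analytic_at)
    \<comment> \<open>The difference quotient of \<open>g\<close>, completed by the derivative at
      \<open>z\<close>, is holomorphic by removal of the singularity; it is the numerator for the
      exponent \<open>m\<close>.\<close>
    define k where "k = (\<lambda>w. if w = z then deriv g z else (g w - g z) / (w - z))"
    have "k holomorphic_on U"
      unfolding k_def by (rule pole_lemma_open) (use U in auto)
    then have "k analytic_on {z}" using U by (auto simp: analytic_at)
    from Suc.IH[OF this] obtain p h where ph: "h analytic_on {z}"
      "\<forall>\<^sub>F w in at z. k w / (w - z) ^ m = poly p (1 / (w - z)) + h w" by blast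
    have ne: "\<forall>\<^sub>F w in at z. w \<noteq> z"
      by (simp add: eventually_neq_at_within)
    have "\<forall>\<^sub>F w in at z. g w / (w - z) ^ Suc m = poly (p + monom (g z) (Suc m)) (1 / (w - z)) + h w"
      using ph(2) ne
    proof eventually_elim
      case (elim w)
      have "g w / (w - z) ^ Suc m = g z * (1 / (w - z)) ^ Suc m + k w / (w - z) ^ m"
        using elim(2) by (simp add: k_def power_divide divide_simps)
      then show ?case using elim by (simp add: poly_monom)
    qed
    then show ?case using ph(1) by blast
  qed
  then obtain p h where h: "h analytic_on {z}"
      and p: "\<forall>\<^sub>F w in at z. g w / (w - z) ^ m = poly p (1 / (w - z)) + h w" by blast
  have "\<forall>\<^sub>F w in at z. f w = poly p (1 / (w - z)) + h w"
    using g(2) p by eventually_elim simp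
  with h show ?thesis by (rule that)
qed

section \<open>Approximation of polar parts by functions holomorphic on the domain\<close>

lemma holomorphic_ball_poly_approx:
  fixes g :: "complex \<Rightarrow> complex"
  assumes "g holomorphic_on ball 0 r" "0 < s" "s < r" "0 < e"
  obtains p where "\<And>u. norm u \<le> s \<Longrightarrow> norm (g u - poly p u) \<le> e"
proof -
  define c where "c = (\<lambda>n. (deriv ^^ n) g 0 / fact n)"
  have sums: "(\<lambda>n. c n * u ^ n) sums g u" if "norm u < r" for u
    using holomorphic_power_series[OF assms(1), of u] that by (simp add: c_def)
  \<comment> \<open>Convergence at a point of modulus \<open>t\<close> makes the radius of
    convergence strictly larger than \<open>s\<close>, so the Taylor sums converge uniformly on the
    closed disc of radius \<open>s\<close>.\<close>
  obtain t where t: "s < t" "t < r" using assms dense by blast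
  have "conv_radius c \<ge> norm (of_real t :: complex)"
    by (rule conv_radius_geI[of c "of_real t"]) (use sums[of "of_real t"] t assms in \<open>auto simp: sums_iff\<close>)
  then have "ereal s < conv_radius c"
    using t assms by (metis abs_of_pos less_ereal.simps(1) less_trans norm_of_real order_less_le_trans)
  from powser_uniform_limit[OF this, of 0]
  have ul: "uniform_limit (cball 0 s) (\<lambda>n u. \<Sum>i<n. c i * u ^ i) (\<lambda>u. \<Sum>i. c i * u ^ i) sequentially"
    by simp
  then have "\<forall>\<^sub>F n in sequentially. \<forall>u\<in>cball 0 s. dist (\<Sum>i<n. c i * u ^ i) (\<Sum>i. c i * u ^ i) < e"
    using \<open>0 < e\<close> by (auto simp: uniform_limit_iff)
  then obtain n where n: "\<And>u. u \<in> cball 0 s \<Longrightarrow> dist (\<Sum>i<n. c i * u ^ i) (\<Sum>i. c i * u ^ i) < e"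
    unfolding eventually_sequentially by blast
  show ?thesis
  proof (rule that[of "\<Sum>i<n. monom (c i) i"])
    fix u :: complex assume u: "norm u \<le> s"
    have "(\<Sum>i. c i * u ^ i) = g u"
      using sums[of u] u assms by (simp add: sums_iff)
    then show "norm (g u - poly (\<Sum>i<n. monom (c i) i) u) \<le> e"
      using n[of u] u by (simp add: dist_norm norm_minus_commute poly_sum poly_monom)
  qed
qed

text \<open>The pole is pushed from \<open>z\<close> to \<open>w\<close>. In the variable
  \<open>u = 1 / (v - w)\<close> one has \<open>1 / (v - z) = u / (1 - u * (z - w))\<close>, which
  is holomorphic for \<open>norm u < 1 / norm (z - w)\<close>; a polynomial in \<open>u\<close>
  approximates it on the disc of half that radius.\<close>

lemma polar_approx_near_infinity:
  fixes z w :: complex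
  assumes "z \<noteq> w" "0 < e"
  obtains T where "T holomorphic_on -{w}"
    "\<And>v. norm (v - w) \<ge> 2 * norm (z - w) \<Longrightarrow> norm (poly p (1 / (v - z)) - T v) \<le> e"
proof -
  define d where "d = norm (z - w)"
  have d: "d > 0" using assms by (simp add: d_def)
  define g where "g = (\<lambda>u. poly p (u / (1 - u * (z - w))))"
  have "1 - u * (z - w) \<noteq> 0" if "u \<in> ball 0 (1 / d)" for u
  proof
    assume "1 - u * (z - w) = 0"
    then have "norm (u * (z - w)) = 1" by simp
    then have "norm u * d = 1" by (simp add: norm_mult d_def)
    moreover have "norm u * d < 1" using that d by (simp add: field_simps)
    ultimately show False by simp
  qed
  then have "g holomorphic_on ball 0 (1 / d)"
    unfolding g_def by (intro holomorphic_intros) auto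
  then obtain q where q: "\<And>u. norm u \<le> 1 / (2 * d) \<Longrightarrow> norm (g u - poly q u) \<le> e"
    by (rule holomorphic_ball_poly_approx[where s = "1 / (2 * d)" and e = e]) (use d assms in \<open>auto simp: field_simps\<close>)
  show ?thesis
  proof (rule that[of "\<lambda>v. poly q (1 / (v - w))"])
    show "(\<lambda>v. poly q (1 / (v - w))) holomorphic_on -{w}"
      by (intro holomorphic_intros) auto
    fix v assume v: "norm (v - w) \<ge> 2 * norm (z - w)"
    then have vw: "v \<noteq> w" using d by (auto simp: d_def)
    have vz: "v \<noteq> z"
      using v d by (auto simp: d_def)
    have "norm (1 / (v - w)) \<le> 1 / (2 * d)"
      using v d vw by (auto simp: norm_divide d_def intro!: divide_left_mono mult_pos_pos)
    from q[OF this] have "norm (g (1 / (v - w)) - poly q (1 / (v - w))) \<le> e" .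
    moreover have "g (1 / (v - w)) = poly p (1 / (v - z))"
    proof -
      have "1 - 1 / (v - w) * (z - w) = (v - z) / (v - w)" using vw by (simp add: field_simps)
      then show ?thesis using vw vz by (simp add: g_def)
    qed
    ultimately show "norm (poly p (1 / (v - z)) - poly q (1 / (v - w))) \<le> e" by simp
  qed
qed

lemma polar_approx_near_zero:
  fixes z :: complex
  assumes "z \<noteq> 0" "0 < e"
  obtains T where "T holomorphic_on UNIV"
    "\<And>v. norm v \<le> norm z / 2 \<Longrightarrow> norm (poly p (1 / (v - z)) - T v) \<le> e"
proof -
  have "(\<lambda>v. poly p (1 / (v - z))) holomorphic_on ball 0 (norm z)"
    by (intro holomorphic_intros) auto
  then obtain q where q: "\<And>v. norm v \<le> norm z / 2 \<Longrightarrow> norm (poly p (1 / (v - z)) - poly q v) \<le> e"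
    by (rule holomorphic_ball_poly_approx[where s = "norm z / 2" and e = e]) (use assms in auto)
  show ?thesis
    by (rule that[of "poly q"]) (use q in \<open>auto intro!: holomorphic_intros\<close>)
qed

text \<open>\<open>B\<close> is the exceptional set outside which the correction \<open>T\<close> is
  good. The last conclusion prepares local finiteness: if \<open>B\<close> comes close to
  \<open>q\<close>, then \<open>z\<close> is \<open>0\<close> or lies in a compact subset of
  \<open>U\<close> that depends only on \<open>q\<close> and \<open>\<delta>\<close>.\<close>

lemma polar_approx_on_open:
  fixes U :: "complex set"
  assumes U: "open U" "z \<in> U" and e: "0 < e"
  obtains T B where "T holomorphic_on U" "z \<in> B"
    "\<And>v. v \<in> U - B \<Longrightarrow> norm (poly p (1 / (v - z)) - T v) \<le> e"
    "\<And>q \<delta>. 0 < \<delta> \<Longrightarrow> ball q (2 * \<delta>) \<subseteq> U \<Longrightarrow> B \<inter> ball q \<delta> \<noteq> {} \<Longrightarrow>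
       z = 0 \<or> norm z \<le> 2 / \<delta> + 2 * (norm q + \<delta>) \<and>
         (\<forall>w. w \<notin> U \<longrightarrow> norm (w - z) \<ge> min (\<delta> / 2) (1 / (2 * (norm q + \<delta>))))"
proof -
  \<comment> \<open>The product of \<open>norm z\<close> and the distance from \<open>z\<close> to
    the complement decides. If it is below 1, a lower bound on the distance bounds
    \<open>norm z\<close>; if it is at least 1, an upper bound on \<open>norm z\<close> bounds the
    distance from below. Either way one estimate on \<open>z\<close> yields the other. For
    \<open>U = UNIV\<close> the third case holds vacuously unless \<open>z = 0\<close>.\<close>
  consider (zero) "z = 0"
    | (near) w where "w \<notin> U" "\<And>w'. w' \<notin> U \<Longrightarrow> norm (w - z) \<le> norm (w' - z)" "norm (w - z) * norm z < 1"
    | (far) "z \<noteq> 0" "\<And>w. w \<notin> U \<Longrightarrow> norm (w - z) * norm z \<ge> 1"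
  proof (cases "U = UNIV")
    case True
    then show ?thesis using that by blast
  next
    case False
    then obtain w where w: "w \<in> -U" "\<And>w'. w' \<in> -U \<Longrightarrow> dist z w \<le> dist z w'"
      using distance_attains_inf[of "-U" z] U by (metis ComplI UNIV_eq_I closed_Compl empty_iff)
    then have w': "w \<notin> U" "\<And>w'. w' \<notin> U \<Longrightarrow> norm (w - z) \<le> norm (w' - z)"
      by (auto simp: dist_norm norm_minus_commute)
    show ?thesis
    proof (cases "norm (w - z) * norm z < 1")
      case True
      then show ?thesis using that(2) w' by blast
    next
      case False
      have "norm (w' - z) * norm z \<ge> 1" if "w' \<notin> U" for w'
        using w'(2)[OF that] False
        by (meson linorder_not_less mult_right_mono norm_ge_zero order_trans)
      then show ?thesis using that(1,3) by blast
    qed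
  qed
  then show ?thesis
  proof cases
    case zero
    show ?thesis
      \<comment> \<open>At \<open>z = 0\<close> nothing is approximated; this can concern only one
        pole, so it does not disturb local finiteness.\<close>
      by (rule that[of "\<lambda>_. 0" UNIV]) (use zero in auto)
  next
    case near
    define d where "d = norm (w - z)"
    have d: "d > 0" using near U by (auto simp: d_def)
    then have "z \<noteq> w" by (auto simp: d_def)
    from polar_approx_near_infinity[OF this e, of p] obtain T where T: "T holomorphic_on -{w}"
      "\<And>v. norm (v - w) \<ge> 2 * norm (z - w) \<Longrightarrow> norm (poly p (1 / (v - z)) - T v) \<le> e" by blast
    show ?thesis
    proof (rule that[of T "ball w (2 * d)"])
      show "T holomorphic_on U" using T(1) near(1) by (auto intro: holomorphic_on_subset)
      show "z \<in> ball w (2 * d)" using d by (auto simp: d_def dist_norm)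
      show "norm (poly p (1 / (v - z)) - T v) \<le> e" if "v \<in> U - ball w (2 * d)" for v
        using T(2)[of v] that by (auto simp: d_def dist_norm norm_minus_commute)
      fix q :: complex and \<delta> :: real assume q: "0 < \<delta>" "ball q (2 * \<delta>) \<subseteq> U" "ball w (2 * d) \<inter> ball q \<delta> \<noteq> {}"
      then obtain v where v: "dist w v < 2 * d" "dist q v < \<delta>" by auto
      \<comment> \<open>Since \<open>w\<close> is outside \<open>U\<close>, it is at least
        \<open>2 * \<delta>\<close> from \<open>q\<close>; a point \<open>v\<close> within
        \<open>\<delta>\<close> of \<open>q\<close> and \<open>2 * d\<close> of \<open>w\<close>
        then forces \<open>d > \<delta> / 2\<close>.\<close>
      have "dist q w \<ge> 2 * \<delta>" using q(2) near(1) by (meson linorder_not_less mem_ball subsetD)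
      moreover have "dist q w \<le> dist q v + dist w v" by (simp add: dist_triangle2)
      ultimately have dd: "d > \<delta> / 2" using v by simp
      have "norm z < 1 / d" using near(3) d by (simp add: d_def field_simps)
      also have "\<dots> \<le> 2 / \<delta>" using dd d q by (simp add: field_simps)
      finally have "norm z \<le> 2 / \<delta> + 2 * (norm q + \<delta>)" using q(1) by (intro add_increasing2) auto
      moreover have "norm (w' - z) \<ge> \<delta> / 2" if "w' \<notin> U" for w'
        using near(2)[OF that] dd by (simp add: d_def)
      ultimately show "z = 0 \<or> norm z \<le> 2 / \<delta> + 2 * (norm q + \<delta>) \<and>
         (\<forall>w. w \<notin> U \<longrightarrow> norm (w - z) \<ge> min (\<delta> / 2) (1 / (2 * (norm q + \<delta>))))"
        by (auto simp: min_le_iff_disj)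
    qed
  next
    case far
    from polar_approx_near_zero[OF far(1) e, of p] obtain T where T: "T holomorphic_on UNIV"
      "\<And>v. norm v \<le> norm z / 2 \<Longrightarrow> norm (poly p (1 / (v - z)) - T v) \<le> e" by blast
    show ?thesis
    proof (rule that[of T "{v. norm v > norm z / 2}"])
      show "T holomorphic_on U" using T(1) by (auto intro: holomorphic_on_subset)
      show "z \<in> {v. norm v > norm z / 2}" using far by auto
      show "norm (poly p (1 / (v - z)) - T v) \<le> e" if "v \<in> U - {v. norm v > norm z / 2}" for v
        using T(2)[of v] that by auto
      fix q :: complex and \<delta> :: real
      assume q: "0 < \<delta>" "ball q (2 * \<delta>) \<subseteq> U" "{v. norm v > norm z / 2} \<inter> ball q \<delta> \<noteq> {}"
      then obtain v where v: "norm z / 2 < norm v" "dist q v < \<delta>" by auto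
      have "norm v \<le> norm q + dist q v"
        by (metis dist_commute dist_norm norm_triangle_sub)
      then have nz: "norm z \<le> 2 * (norm q + \<delta>)" using v by simp
      have "norm (w - z) \<ge> 1 / (2 * (norm q + \<delta>))" if "w \<notin> U" for w
      proof -
        have "1 \<le> norm (w - z) * norm z" using far(2)[OF that] .
        also have "\<dots> \<le> norm (w - z) * (2 * (norm q + \<delta>))"
          by (intro mult_left_mono nz) auto
        finally show ?thesis using q(1) norm_ge_zero[of q]
          by (subst pos_divide_le_eq) (auto simp: add_nonneg_pos)
      qed
      moreover have "norm z \<le> 2 / \<delta> + 2 * (norm q + \<delta>)"
        using nz q(1) by (simp add: add_increasing)
      ultimately show "z = 0 \<or> norm z \<le> 2 / \<delta> + 2 * (norm q + \<delta>) \<and>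
         (\<forall>w. w \<notin> U \<longrightarrow> norm (w - z) \<ge> min (\<delta> / 2) (1 / (2 * (norm q + \<delta>))))"
        by (auto simp: min_le_iff_disj)
    qed
  qed
qed

lemma compact_away_from_complement:
  fixes U :: "complex set"
  assumes "\<eta> > 0"
  shows "compact {z. norm z \<le> M \<and> (\<forall>w. w \<notin> U \<longrightarrow> norm (w - z) \<ge> \<eta>)}"
    and "{z. norm z \<le> M \<and> (\<forall>w. w \<notin> U \<longrightarrow> norm (w - z) \<ge> \<eta>)} \<subseteq> U"
proof -
  have eq: "{z. norm z \<le> M \<and> (\<forall>w. w \<notin> U \<longrightarrow> norm (w - z) \<ge> \<eta>)} = cball 0 M \<inter> (\<Inter>w\<in>-U. - ball w \<eta>)"
    by (auto simp: dist_norm not_less)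
  show "compact {z. norm z \<le> M \<and> (\<forall>w. w \<notin> U \<longrightarrow> norm (w - z) \<ge> \<eta>)}"
    unfolding eq by (intro compact_Int_closed) auto
  show "{z. norm z \<le> M \<and> (\<forall>w. w \<notin> U \<longrightarrow> norm (w - z) \<ge> \<eta>)} \<subseteq> U"
    using assms by force
qed

text \<open>The function is the sum of all corrected polar parts. Near a given point only finitely
  many exceptional sets intervene; the other terms are dominated by a convergent series, so their
  sum is holomorphic there by the Weierstrass M-test.\<close>

theorem mittag_leffler_open:
  fixes P :: "complex \<Rightarrow> complex \<Rightarrow> complex"
  assumes U: "open U" "Z \<subseteq> U" "Z sparse_in U"
    and P: "\<And>z. z \<in> Z \<Longrightarrow> P z meromorphic_on {z}"
  obtains F where "F holomorphic_on U - Z"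
    "\<And>z. z \<in> Z \<Longrightarrow> \<exists>h. h analytic_on {z} \<and> (\<forall>\<^sub>F w in at z. F w = P z w + h w)"
proof -
  have "\<exists>p h. h analytic_on {z} \<and> (\<forall>\<^sub>F w in at z. P z w = poly p (1 / (w - z)) + h w)"
    if "z \<in> Z" for z
    using meromorphic_at_principal_part[OF P[OF that]] by metis
  then obtain p k where k: "\<And>z. z \<in> Z \<Longrightarrow> k z analytic_on {z}"
    and p: "\<And>z. z \<in> Z \<Longrightarrow> \<forall>\<^sub>F w in at z. P z w = poly (p z) (1 / (w - z)) + k z w"
    by metis
  have cZ: "countable Z"
    using sparse_imp_countable[OF U(1,3)] U(2) by (simp add: Int_absorb1)
  \<comment> \<open>Errors that decrease geometrically along an enumeration of the countable set
    \<open>Z\<close> are summable.\<close>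
  define \<epsilon> where "\<epsilon> = (\<lambda>z. (1 / 2 :: real) ^ to_nat_on Z z)"
  have "(\<lambda>n. (1 / 2 :: real) ^ n) summable_on to_nat_on Z ` Z"
    by (rule summable_on_subset_banach[OF norm_summable_imp_summable_on]) (auto intro: summable_geometric)
  then have \<epsilon>: "\<epsilon> summable_on Z"
    using cZ by (subst (asm) summable_on_reindex) (auto simp: \<epsilon>_def o_def)
  define Q where "Q = (\<lambda>z T B. T holomorphic_on U \<and> z \<in> B \<and>
    (\<forall>v\<in>U - B. norm (poly (p z) (1 / (v - z)) - T v) \<le> \<epsilon> z) \<and>
    (\<forall>q \<delta>. 0 < \<delta> \<longrightarrow> ball q (2 * \<delta>) \<subseteq> U \<longrightarrow> B \<inter> ball q \<delta> \<noteq> {} \<longrightarrow>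
       z = 0 \<or> norm z \<le> 2 / \<delta> + 2 * (norm q + \<delta>) \<and>
         (\<forall>w. w \<notin> U \<longrightarrow> norm (w - z) \<ge> min (\<delta> / 2) (1 / (2 * (norm q + \<delta>))))))"
  have "\<exists>T B. Q z T B" if "z \<in> Z" for z
  proof -
    have "z \<in> U" "0 < \<epsilon> z" using U that by (auto simp: \<epsilon>_def)
    from polar_approx_on_open[OF U(1) this, of "p z"] show ?thesis
      unfolding Q_def by metis
  qed
  then obtain T B where Q: "\<And>z. z \<in> Z \<Longrightarrow> Q z (T z) (B z)"
    by metis
  have T: "T z holomorphic_on U" and B: "z \<in> B z" if "z \<in> Z" for z
    using Q[OF that] by (auto simp: Q_def)
  have TB: "norm (poly (p z) (1 / (v - z)) - T z v) \<le> \<epsilon> z" if "z \<in> Z" "v \<in> U - B z" for z v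
    using Q[OF that(1)] that(2) by (auto simp: Q_def)
  have loc: "z = 0 \<or> norm z \<le> 2 / \<delta> + 2 * (norm q + \<delta>) \<and>
      (\<forall>w. w \<notin> U \<longrightarrow> norm (w - z) \<ge> min (\<delta> / 2) (1 / (2 * (norm q + \<delta>))))"
    if "z \<in> Z" "0 < \<delta>" "ball q (2 * \<delta>) \<subseteq> U" "B z \<inter> ball q \<delta> \<noteq> {}" for z q \<delta>
    using Q[OF that(1)] that(2-) unfolding Q_def by blast
  define E where "E = (\<lambda>z v. poly (p z) (1 / (v - z)) - T z v)"
  define F where "F = (\<lambda>v. \<Sum>\<^sub>\<infinity>z\<in>Z. E z v)"
  have holE: "E z holomorphic_on U - {z}" if "z \<in> Z" for z
    unfolding E_def using T[OF that]
    by (intro holomorphic_intros) (auto intro: holomorphic_on_subset)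
  have anE: "E z analytic_on {q}" if "z \<in> Z" "q \<in> U" "q \<noteq> z" for z q
    unfolding analytic_at using holE[OF that(1)] that(2,3) U(1)
    by (intro exI[of _ "U - {z}"]) auto
  \<comment> \<open>The poles concerned lie in the compact set \<open>K\<close>, apart from possibly
    \<open>0\<close>, and a sparse set meets a compact subset of \<open>U\<close> in finitely many
    points.\<close>
  have fin: "finite {z \<in> Z. B z \<inter> ball q \<delta> \<noteq> {}}" if "0 < \<delta>" "ball q (2 * \<delta>) \<subseteq> U" for q \<delta>
  proof -
    define \<eta> where "\<eta> = min (\<delta> / 2) (1 / (2 * (norm q + \<delta>)))"
    define K where "K = {z. norm z \<le> 2 / \<delta> + 2 * (norm q + \<delta>) \<and> (\<forall>w. w \<notin> U \<longrightarrow> norm (w - z) \<ge> \<eta>)}"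
    have "\<eta> > 0" using that by (auto simp: \<eta>_def add_nonneg_pos)
    then have K: "compact K" "K \<subseteq> U" unfolding K_def by (rule compact_away_from_complement)+
    have "finite (K \<inter> Z)"
      using K U(3) by (metis sparse_in_compact_finite sparse_in_subset)
    moreover have "{z \<in> Z. B z \<inter> ball q \<delta> \<noteq> {}} \<subseteq> insert 0 (K \<inter> Z)"
      using loc[OF _ that] by (auto simp: K_def \<eta>_def)
    ultimately show ?thesis by (meson finite_insert finite_subset)
  qed
  \<comment> \<open>Around \<open>q\<close> the sum splits into the finitely many terms from
    \<open>Z0\<close>, which may have poles, and a holomorphic remainder \<open>H\<close>.\<close>
  have local: "\<exists>s Z0 H. s > 0 \<and> finite Z0 \<and> Z0 \<subseteq> Z \<and> ball q s \<inter> Z \<subseteq> Z0 \<and> H holomorphic_on ball q s \<and>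
      (\<forall>v\<in>ball q s. F v = (\<Sum>z\<in>Z0. E z v) + H v)" if q: "q \<in> U" for q
  proof -
    obtain r where r: "r > 0" "ball q r \<subseteq> U" using U(1) q by (meson openE)
    define \<delta> where "\<delta> = r / 2"
    have \<delta>: "\<delta> > 0" "ball q (2 * \<delta>) \<subseteq> U" using r by (auto simp: \<delta>_def)
    define Z0 where "Z0 = {z \<in> Z. B z \<inter> ball q \<delta> \<noteq> {}}"
    define H where "H = (\<lambda>v. \<Sum>\<^sub>\<infinity>z\<in>Z - Z0. E z v)"
    have sub: "cball q (\<delta> / 2) \<subseteq> ball q \<delta>" "ball q \<delta> \<subseteq> U" using \<delta> by auto
    have bound: "norm (E z v) \<le> \<epsilon> z" if "z \<in> Z - Z0" "v \<in> cball q (\<delta> / 2)" for z v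
      unfolding E_def using that sub by (intro TB) (auto simp: Z0_def)
    have \<epsilon>': "\<epsilon> summable_on (Z - Z0)" using \<epsilon> by (rule summable_on_subset_banach) auto
    have ul: "uniform_limit (cball q (\<delta> / 2)) (\<lambda>X v. \<Sum>z\<in>X. E z v) H (finite_subsets_at_top (Z - Z0))"
      unfolding H_def by (rule Weierstrass_m_test_general[OF bound \<epsilon>']) auto
    \<comment> \<open>A pole belongs to its own exceptional set, so the terms outside
      \<open>Z0\<close> have no pole in \<open>ball q \<delta>\<close>.\<close>
    have hol1: "E z holomorphic_on ball q \<delta>" if "z \<in> Z - Z0" for z
    proof (rule holomorphic_on_subset[OF holE])
      show "ball q \<delta> \<subseteq> U - {z}" using sub B[of z] that by (auto simp: Z0_def)
    qed (use that in auto)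
    have "H holomorphic_on ball q (\<delta> / 2)"
    proof (rule holomorphic_uniform_limit[OF _ ul])
      show "\<forall>\<^sub>F X in finite_subsets_at_top (Z - Z0). continuous_on (cball q (\<delta> / 2)) (\<lambda>v. \<Sum>z\<in>X. E z v) \<and>
          (\<lambda>v. \<Sum>z\<in>X. E z v) holomorphic_on ball q (\<delta> / 2)"
      proof (rule eventually_finite_subsets_at_top_weakI)
        fix X assume X: "finite X" "X \<subseteq> Z - Z0"
        then have "(\<lambda>v. \<Sum>z\<in>X. E z v) holomorphic_on ball q \<delta>"
          using hol1 by (intro holomorphic_on_sum) auto
        then show "continuous_on (cball q (\<delta> / 2)) (\<lambda>v. \<Sum>z\<in>X. E z v) \<and>
          (\<lambda>v. \<Sum>z\<in>X. E z v) holomorphic_on ball q (\<delta> / 2)"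
          using sub by (meson ball_subset_cball continuous_on_subset holomorphic_on_imp_continuous_on holomorphic_on_subset)
      qed
    qed auto
    moreover have fZ: "finite Z0" unfolding Z0_def by (rule fin[OF \<delta>])
    moreover have ZZ: "Z0 \<subseteq> Z" by (auto simp: Z0_def)
    moreover have "\<forall>v\<in>ball q (\<delta> / 2). F v = (\<Sum>z\<in>Z0. E z v) + H v"
    proof
      fix v assume v: "v \<in> ball q (\<delta> / 2)"
      have "(\<lambda>z. norm (E z v)) summable_on (Z - Z0)"
        by (rule Infinite_Sum.abs_summable_on_comparison_test'[OF \<epsilon>' bound]) (use v in auto)
      then have "(\<lambda>z. E z v) summable_on (Z - Z0)"
        by (rule abs_summable_summable)
      moreover have "(\<lambda>z. E z v) summable_on Z0"
        using fZ by (rule summable_on_finite)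
      ultimately have "(\<Sum>\<^sub>\<infinity>z\<in>Z0 \<union> (Z - Z0). E z v) = (\<Sum>\<^sub>\<infinity>z\<in>Z0. E z v) + H v"
        unfolding H_def by (subst infsum_Un_disjoint) auto
      then show "F v = (\<Sum>z\<in>Z0. E z v) + H v"
        using fZ ZZ by (simp add: F_def Un_absorb1)
    qed
    moreover have "ball q (\<delta> / 2) \<inter> Z \<subseteq> Z0"
    proof
      fix z assume z: "z \<in> ball q (\<delta> / 2) \<inter> Z"
      then have "z \<in> B z \<inter> ball q \<delta>" using B[of z] \<delta>(1) by auto
      then show "z \<in> Z0" using z by (auto simp: Z0_def)
    qed
    moreover have "\<delta> / 2 > 0" using \<delta> by simp
    ultimately show ?thesis by blast
  qed
  show ?thesis
  proof (rule that[of F])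
    have "F analytic_on {q}" if q: "q \<in> U - Z" for q
    proof -
      obtain s Z0 H where *: "s > 0" "finite Z0" "Z0 \<subseteq> Z" "H holomorphic_on ball q s"
        "\<forall>v\<in>ball q s. F v = (\<Sum>z\<in>Z0. E z v) + H v" using local[of q] q by (metis DiffD1)
      have H: "H analytic_on {q}"
        unfolding analytic_at using * by (intro exI[of _ "ball q s"]) auto
      have "E z analytic_on {q}" if "z \<in> Z0" for z
        using that q *(3) by (intro anE) auto
      then have "(\<lambda>v. (\<Sum>z\<in>Z0. E z v) + H v) analytic_on {q}"
        by (intro analytic_intros H)
      moreover have "\<forall>\<^sub>F v in nhds q. F v = (\<Sum>z\<in>Z0. E z v) + H v"
      proof (rule eventually_mono)
        show "\<forall>\<^sub>F v in nhds q. v \<in> ball q s"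
          using *(1) by (intro eventually_nhds_in_open) auto
      qed (use * in blast)
      ultimately show ?thesis by (simp add: analytic_at_cong)
    qed
    then have "F analytic_on U - Z" by (subst analytic_on_analytic_at) blast
    then show "F holomorphic_on U - Z" by (rule analytic_imp_holomorphic)
    fix q assume q: "q \<in> Z"
    then obtain s Z0 H where *: "s > 0" "finite Z0" "Z0 \<subseteq> Z" "H holomorphic_on ball q s" "ball q s \<inter> Z \<subseteq> Z0"
      "\<forall>v\<in>ball q s. F v = (\<Sum>z\<in>Z0. E z v) + H v" using local[OF subsetD[OF U(2) q]] by metis
    \<comment> \<open>What remains beside \<open>P q\<close>: the other terms of the local
      splitting, the correction \<open>T q\<close>, and the analytic part \<open>k q\<close> by
      which \<open>P q\<close> exceeds its polynomial polar part.\<close>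
    define h where "h = (\<lambda>v. (\<Sum>z\<in>Z0 - {q}. E z v) + H v - T q v - k q v)"
    have qZ0: "q \<in> Z0" using * q by auto
    have "T q analytic_on {q}"
      unfolding analytic_at using T[OF q] U q by (intro exI[of _ U]) auto
    moreover have "H analytic_on {q}"
      unfolding analytic_at using * by (intro exI[of _ "ball q s"]) auto
    moreover have "E z analytic_on {q}" if "z \<in> Z0 - {q}" for z
      using that q *(3) U(2) by (intro anE) auto
    ultimately have "h analytic_on {q}"
      unfolding h_def by (intro analytic_intros k[OF q])
    moreover have "\<forall>\<^sub>F w in at q. w \<in> ball q s"
      using * by (intro eventually_at_in_open') auto
    with p[OF q] have "\<forall>\<^sub>F w in at q. F w = P q w + h w"
    proof eventually_elim
      case (elim w)
      have "F w = E q w + (\<Sum>z\<in>Z0 - {q}. E z w) + H w"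
        using *(6) elim(2) sum.remove[OF *(2) qZ0, of "\<lambda>z. E z w"] by simp
      then show ?case using elim by (simp add: h_def E_def)
    qed
    ultimately show "\<exists>h. h analytic_on {q} \<and> (\<forall>\<^sub>F w in at q. F w = P q w + h w)" by blast
  qed
qed

section \<open>Symmetrization under complex conjugation\<close>

lemma open_compose_cnj: "open U \<Longrightarrow> open {z. cnj z \<in> U}"
  using continuous_open_vimage[of U cnj] by (simp add: continuous_on_cnj vimage_def)

lemma analytic_cnj_conj:
  assumes "h analytic_on {cnj z}"
  shows "(cnj \<circ> h \<circ> cnj) analytic_on {z}"
proof -
  obtain U where U: "open U" "cnj z \<in> U" "h holomorphic_on U"
    using assms by (auto simp: analytic_at)
  have "(cnj \<circ> h \<circ> cnj) holomorphic_on {z. cnj z \<in> U}"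
    using U open_compose_cnj[OF U(1)] unfolding holomorphic_on_open[OF U(1)] holomorphic_on_open[OF open_compose_cnj[OF U(1)]]
    by (metis complex_cnj_cnj field_differentiable_cnj_cnj field_differentiable_def mem_Collect_eq)
  then show ?thesis
    using U open_compose_cnj[of U] by (auto simp: analytic_at)
qed

text \<open>The prescriptions at \<open>z\<close> and \<open>cnj z\<close> are reflections of each
  other, so \<open>F\<close> and its reflection have the same polar part at each point, and so has
  their average. The average is symmetric at every complex number, also outside \<open>U\<close>, as
  the later notion \<open>intrinsic\<close> demands.\<close>

lemma mittag_leffler_symmetric:
  fixes P :: "complex \<Rightarrow> complex \<Rightarrow> complex"
  assumes U: "open U" "Z \<subseteq> U" "Z sparse_in U"
    and sym: "\<And>z. z \<in> Z \<Longrightarrow> cnj z \<in> Z" "\<And>z. z \<in> U \<Longrightarrow> cnj z \<in> U"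
    and P: "\<And>z. z \<in> Z \<Longrightarrow> P z meromorphic_on {z}"
      "\<And>z w. z \<in> Z \<Longrightarrow> P (cnj z) (cnj w) = cnj (P z w)"
  obtains F where "F holomorphic_on U - Z" "\<And>z. F (cnj z) = cnj (F z)"
    "\<And>z. z \<in> Z \<Longrightarrow> \<exists>h. h analytic_on {z} \<and> (\<forall>\<^sub>F w in at z. F w = P z w + h w)"
proof -
  obtain F where F: "F holomorphic_on U - Z"
    "\<And>z. z \<in> Z \<Longrightarrow> \<exists>h. h analytic_on {z} \<and> (\<forall>\<^sub>F w in at z. F w = P z w + h w)"
    using mittag_leffler_open[OF U P(1)] by metis
  define F' where "F' = cnj \<circ> F \<circ> cnj"
  define G where "G = (\<lambda>z. (F z + F' z) / 2)"
  have oUZ: "open (U - Z)" using U by (intro open_diff_sparse_pts)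
  then have anF: "F analytic_on U - Z" using F by (simp add: analytic_on_open)
  have "G analytic_on {z}" if z: "z \<in> U - Z" for z
  proof -
    have "cnj z \<in> U - Z" using z sym by (metis DiffE DiffI complex_cnj_cnj)
    then have "F' analytic_on {z}"
      unfolding F'_def using anF by (intro analytic_cnj_conj) (auto intro: analytic_on_subset)
    moreover have "F analytic_on {z}" using anF z by (auto intro: analytic_on_subset)
    ultimately show ?thesis unfolding G_def by (intro analytic_intros) auto
  qed
  then have "G analytic_on U - Z" by (subst analytic_on_analytic_at) blast
  then have holG: "G holomorphic_on U - Z" by (rule analytic_imp_holomorphic)
  show ?thesis
  proof (rule that[OF holG])
    show "G (cnj z) = cnj (G z)" for z by (simp add: G_def F'_def add.commute)
    fix z assume z: "z \<in> Z"
    obtain h1 where h1: "h1 analytic_on {z}" "\<forall>\<^sub>F w in at z. F w = P z w + h1 w"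
      using F(2)[OF z] by blast
    obtain h2 where h2: "h2 analytic_on {cnj z}" "\<forall>\<^sub>F w in at (cnj z). F w = P (cnj z) w + h2 w"
      using F(2)[OF sym(1)[OF z]] by blast
    define h2' where "h2' = cnj \<circ> h2 \<circ> cnj"
    have "filterlim cnj (at (cnj z)) (at z)"
      by (auto simp: filterlim_at eventually_at_filter intro!: tendsto_intros)
    with h2(2) have "\<forall>\<^sub>F w in at z. F (cnj w) = P (cnj z) (cnj w) + h2 (cnj w)"
      by (rule eventually_compose_filterlim)
    with h1(2) have "\<forall>\<^sub>F w in at z. G w = P z w + (h1 w + h2' w) / 2"
    proof eventually_elim
      case (elim w)
      then show ?case by (simp add: G_def F'_def h2'_def P(2)[OF z] field_simps)
    qed
    moreover have "h2' analytic_on {z}"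
      unfolding h2'_def by (intro analytic_cnj_conj h2)
    then have "(\<lambda>w. (h1 w + h2' w) / 2) analytic_on {z}"
      using h1(1) by (intro analytic_intros) auto
    ultimately show "\<exists>h. h analytic_on {z} \<and> (\<forall>\<^sub>F w in at z. G w = P z w + h w)" by blast
  qed
qed

section \<open>Spherical power series\<close>

text \<open>Grouping by parity about \<open>x\<close> turns \<open>K\<close> into two functions of \<open>(z - x)\<^sup>2 + y\<^sup>2\<close>; on a
  small sphere neighbourhood the square root needed to express them in this variable is
  single-valued.\<close>

lemma spherical_power_series:
  fixes x y R :: real and K :: "complex \<Rightarrow> complex"
  defines "s \<equiv> \<lambda>z. (z - of_real x)\<^sup>2 + (of_real y)\<^sup>2"
  assumes R: "R > 0" "y \<noteq> 0 \<Longrightarrow> R \<le> \<bar>y\<bar>"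
    and K: "K holomorphic_on {z. norm (s z) < R\<^sup>2}"
  obtains c d where "\<And>z. norm (s z) < R\<^sup>2 \<Longrightarrow> (\<lambda>j. s z ^ j * (c j + z * d j)) sums K z"
proof -
  define V where "V = {z. norm (s z) < R\<^sup>2}"
  have "\<exists>c d. \<forall>z. norm (s z) < R\<^sup>2 \<longrightarrow> (\<lambda>j. s z ^ j * (c j + (z - of_real x) * d j)) sums K z"
  proof (cases "y = 0")
    case True
    \<comment> \<open>Here \<open>s z\<close> is the square of \<open>z - x\<close>, so the Taylor
      series has the required form after grouping its terms in consecutive pairs.\<close>
    define a where "a = (\<lambda>n. (deriv ^^ n) K (of_real x) / fact n)"
    have sz: "s z = (z - of_real x)\<^sup>2" for z using True by (simp add: s_def)
    have V: "{z. norm (s z) < R\<^sup>2} = ball (of_real x) R"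
      using R by (auto simp: sz norm_power dist_norm norm_minus_commute power_strict_mono
                       dest: power_less_imp_less_base)
    have "(\<lambda>j. s z ^ j * (a (2 * j) + (z - of_real x) * a (2 * j + 1))) sums K z"
      if "norm (s z) < R\<^sup>2" for z
    proof -
      have "z \<in> ball (of_real x) R" using that V by blast
      then have "(\<lambda>n. a n * (z - of_real x) ^ n) sums K z"
        unfolding a_def using K by (intro holomorphic_power_series[of _ _ R]) (auto simp: V)
      then have "(\<lambda>n. \<Sum>i = n * 2..<n * 2 + 2. a i * (z - of_real x) ^ i) sums K z"
        by (rule sums_group) simp
      moreover have "(\<Sum>i = j * 2..<j * 2 + 2. a i * (z - of_real x) ^ i) =
          s z ^ j * (a (2 * j) + (z - of_real x) * a (2 * j + 1))" for j
      proof -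
        have "{j * 2..<j * 2 + 2} = {2 * j, 2 * j + 1}" by auto
        moreover have "(z - of_real x) ^ (2 * j) = s z ^ j" by (simp add: sz power_mult)
        ultimately show ?thesis by (simp add: algebra_simps)
      qed
      ultimately show ?thesis by simp
    qed
    then show ?thesis
      by (intro exI[of _ "\<lambda>j. a (2 * j)"] exI[of _ "\<lambda>j. a (2 * j + 1)"] allI impI)
  next
    case False
    define refl :: "complex \<Rightarrow> complex" where "refl = (\<lambda>z. 2 * of_real x - z)"
    \<comment> \<open>\<open>Ke\<close> and \<open>Ko\<close> are both invariant under the
      reflection of the plane in \<open>x\<close>, and \<open>K\<close> is \<open>Ke\<close> plus
      \<open>z - x\<close> times \<open>Ko\<close>. An invariant function depends on
      \<open>s z\<close> alone.\<close>
    define Ke where "Ke = (\<lambda>z. (K z + K (refl z)) / 2)"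
    define Ko where "Ko = (\<lambda>z. (K z - K (refl z)) / (2 * (z - of_real x)))"
    define root where "root = (\<lambda>\<zeta>. of_real x + \<i> * csqrt ((of_real y)\<^sup>2 - \<zeta>))"
    have s_refl: "s (refl z) = s z" for z
      by (simp add: s_def refl_def power2_eq_square algebra_simps)
    have Ke_refl: "Ke (refl z) = Ke z" for z by (simp add: Ke_def refl_def)
    have Ko_refl: "Ko (refl z) = Ko z" for z
      by (simp add: Ko_def refl_def divide_simps) (auto simp: algebra_simps)
    \<comment> \<open>The bound \<open>R \<le> \<bar>y\<bar>\<close> keeps the argument of
      \<open>csqrt\<close> in the open right half-plane, away from its branch cut; it also keeps
      \<open>root\<close> away from \<open>x\<close>, the zero of the denominator of
      \<open>Ko\<close>.\<close>
    have pos: "Re ((of_real y)\<^sup>2 - \<zeta>) > 0" if "norm \<zeta> < R\<^sup>2" for \<zeta>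
    proof -
      have "R\<^sup>2 \<le> y\<^sup>2" using R False by (metis abs_le_square_iff abs_of_pos)
      moreover have "Re \<zeta> \<le> norm \<zeta>" by (rule complex_Re_le_cmod)
      ultimately have "Re \<zeta> < y\<^sup>2" using that by linarith
      then show ?thesis by (simp flip: of_real_power)
    qed
    have s_root: "s (root \<zeta>) = \<zeta>" for \<zeta>
      by (simp add: s_def root_def power_mult_distrib)
    have root_ne: "root \<zeta> \<noteq> of_real x" if "norm \<zeta> < R\<^sup>2" for \<zeta>
      using pos[OF that] by (auto simp: root_def)
    \<comment> \<open>\<open>root\<close> inverts \<open>s\<close> only up to the reflection, which
      is invisible to \<open>Ke\<close> and \<open>Ko\<close>.\<close>
    have root_s: "root (s z) = z \<or> root (s z) = refl z" for z
    proof -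
      have "(root (s z) - of_real x)\<^sup>2 = (z - of_real x)\<^sup>2"
        using s_root[of "s z"] by (simp add: s_def)
      then have "root (s z) - of_real x = z - of_real x \<or> root (s z) - of_real x = - (z - of_real x)"
        by (simp add: power2_eq_iff)
      then show ?thesis by (auto simp: refl_def algebra_simps)
    qed
    have hol_root: "root holomorphic_on ball 0 (R\<^sup>2)"
      unfolding root_def using pos
      by (intro holomorphic_intros) (force simp: complex_nonpos_Reals_iff)
    have img: "root ` ball 0 (R\<^sup>2) \<subseteq> V" by (auto simp: V_def s_root)
    have holK: "(\<lambda>\<zeta>. K (root \<zeta>)) holomorphic_on ball 0 (R\<^sup>2)"
      using holomorphic_on_compose_gen[OF hol_root, of K V] K img by (simp add: o_def V_def)
    have "(\<lambda>\<zeta>. refl (root \<zeta>)) holomorphic_on ball 0 (R\<^sup>2)"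
      unfolding refl_def by (intro holomorphic_intros hol_root)
    then have holK': "(\<lambda>\<zeta>. K (refl (root \<zeta>))) holomorphic_on ball 0 (R\<^sup>2)"
      using holomorphic_on_compose_gen[of "\<lambda>\<zeta>. refl (root \<zeta>)" "ball 0 (R\<^sup>2)" K V] K
      by (auto simp: o_def V_def image_subset_iff s_refl s_root)
    have ex: "(\<lambda>j. (deriv ^^ j) \<phi> 0 / fact j * s z ^ j) sums \<phi> (s z)"
      if "\<phi> holomorphic_on ball 0 (R\<^sup>2)" "norm (s z) < R\<^sup>2" for \<phi> z
      using holomorphic_power_series[OF that(1), of "s z"] that(2) by simp
    define \<phi>e where "\<phi>e = (\<lambda>\<zeta>. Ke (root \<zeta>))"
    define \<phi>o where "\<phi>o = (\<lambda>\<zeta>. Ko (root \<zeta>))"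
    have "\<phi>e holomorphic_on ball 0 (R\<^sup>2)"
      unfolding \<phi>e_def Ke_def by (intro holomorphic_intros holK holK') auto
    note exe = ex[OF this]
    have "\<phi>o holomorphic_on ball 0 (R\<^sup>2)"
      unfolding \<phi>o_def Ko_def using root_ne by (intro holomorphic_intros holK holK' hol_root) auto
    note exo = ex[OF this]
    have eq: "\<phi>e (s z) = Ke z" "\<phi>o (s z) = Ko z" for z
      using root_s[of z] by (auto simp: \<phi>e_def \<phi>o_def Ke_refl Ko_refl)
    have "(\<lambda>j. s z ^ j * ((deriv ^^ j) \<phi>e 0 / fact j + (z - of_real x) * ((deriv ^^ j) \<phi>o 0 / fact j))) sums K z"
      if z: "norm (s z) < R\<^sup>2" for z
    proof -
      have "z \<noteq> of_real x"
      proof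
        assume "z = of_real x"
        then have "norm (s z) = y\<^sup>2" by (simp add: s_def norm_power)
        moreover have "R\<^sup>2 \<le> y\<^sup>2" using R False by (metis abs_le_square_iff abs_of_pos)
        ultimately show False using z by simp
      qed
      then have "Ke z + (z - of_real x) * Ko z = K z"
        by (simp add: Ke_def Ko_def field_simps)
      then show ?thesis
        using sums_add[OF exe[OF z] sums_mult[OF exo[OF z], of "z - of_real x"]]
        by (simp add: eq algebra_simps)
    qed
    then show ?thesis
      by (intro exI[of _ "\<lambda>j. (deriv ^^ j) \<phi>e 0 / fact j"]
            exI[of _ "\<lambda>j. (deriv ^^ j) \<phi>o 0 / fact j"] allI impI)
  qed
  then obtain c d where "\<And>z. norm (s z) < R\<^sup>2 \<Longrightarrow> (\<lambda>j. s z ^ j * (c j + (z - of_real x) * d j)) sums K z"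
    by blast
  moreover have "s z ^ j * (c j + (z - of_real x) * d j) = s z ^ j * ((c j - of_real x * d j) + z * d j)" for z j
    \<comment> \<open>Expanding \<open>z - x\<close> shifts the factor \<open>x\<close> into the
      constant coefficient.\<close>
    by (simp add: algebra_simps)
  ultimately show ?thesis
    by (intro that[of "\<lambda>j. c j - of_real x * d j" d]) simp
qed

lemma spherical_power_series_real:
  fixes x y R :: real and K :: "complex \<Rightarrow> complex"
  defines "s \<equiv> \<lambda>z. (z - of_real x)\<^sup>2 + (of_real y)\<^sup>2"
  assumes R: "R > 0" "y \<noteq> 0 \<Longrightarrow> R \<le> \<bar>y\<bar>"
    and K: "K holomorphic_on {z. norm (s z) < R\<^sup>2}" "\<And>z. K (cnj z) = cnj (K z)"
  obtains c d :: "nat \<Rightarrow> real"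
  where "\<And>z. norm (s z) < R\<^sup>2 \<Longrightarrow> (\<lambda>j. s z ^ j * (of_real (c j) + z * of_real (d j))) sums K z"
proof -
  obtain c d where cd: "\<And>z. norm (s z) < R\<^sup>2 \<Longrightarrow> (\<lambda>j. s z ^ j * (c j + z * d j)) sums K z"
    using spherical_power_series[where R = R and y = y and x = x and K = K] R K(1) unfolding s_def by blast
  have s_cnj: "s (cnj z) = cnj (s z)" for z by (simp add: s_def)
  show ?thesis
  proof (rule that[of "\<lambda>j. Re (c j)" "\<lambda>j. Re (d j)"])
    fix z assume z: "norm (s z) < R\<^sup>2"
    then have "(\<lambda>j. cnj (s (cnj z) ^ j * (c j + cnj z * d j))) sums cnj (K (cnj z))"
      \<comment> \<open>Conjugating the series at \<open>cnj z\<close> gives a second expansion of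
        \<open>K z\<close>, with conjugated coefficients; the mean of the two has the real parts as
        coefficients.\<close>
      by (subst sums_cnj) (intro cd, simp add: s_cnj)
    from sums_divide[OF sums_add[OF cd[OF z] this], of 2]
    have "(\<lambda>j. (s z ^ j * (c j + z * d j) + s z ^ j * (cnj (c j) + z * cnj (d j))) / 2) sums K z"
      by (simp add: s_cnj K)
    moreover have "(s z ^ j * (c j + z * d j) + s z ^ j * (cnj (c j) + z * cnj (d j))) / 2 =
        s z ^ j * (of_real (Re (c j)) + z * of_real (Re (d j)))" for j
    proof -
      have "(s z ^ j * (c j + z * d j) + s z ^ j * (cnj (c j) + z * cnj (d j))) / 2 =
        s z ^ j * ((c j + cnj (c j)) / 2 + z * ((d j + cnj (d j)) / 2))"
        by (simp add: field_simps)
      also have "(c j + cnj (c j)) / 2 = of_real (Re (c j))" by (simp add: complex_add_cnj)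
      also have "(d j + cnj (d j)) / 2 = of_real (Re (d j))" by (simp add: complex_add_cnj)
      finally show ?thesis .
    qed
    ultimately show "(\<lambda>j. s z ^ j * (of_real (Re (c j)) + z * of_real (Re (d j)))) sums K z"
      by simp
  qed
qed

section \<open>Slices\<close>

lemma quat_of_real_sel [simp]:
  "qRe (of_real r) = r" "qIm1 (of_real r) = 0" "qIm2 (of_real r) = 0" "qIm3 (of_real r) = 0"
  by (simp_all add: of_real_def)

lemma norm_quat_eq: "norm q = sqrt ((qRe q)\<^sup>2 + (qIm1 q)\<^sup>2 + (qIm2 q)\<^sup>2 + (qIm3 q)\<^sup>2)"
  by (simp add: norm_quat_def inner_quat_def power2_eq_square)

lemma of_real_quat_commute: "of_real r * (q :: quat) = q * of_real r"
  by (simp add: of_real_def)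

lemma imag_units_iff:
  "I \<in> imag_units \<longleftrightarrow> qRe I = 0 \<and> (qIm1 I)\<^sup>2 + (qIm2 I)\<^sup>2 + (qIm3 I)\<^sup>2 = 1"
proof
  assume "I \<in> imag_units"
  then have eq: "qRe I * qRe I - qIm1 I * qIm1 I - qIm2 I * qIm2 I - qIm3 I * qIm3 I = - 1"
    "qRe I * qIm1 I = 0" "qRe I * qIm2 I = 0" "qRe I * qIm3 I = 0"
    by (auto simp: imag_units_def power2_eq_square quat_eq_iff algebra_simps)
  \<comment> \<open>A nonzero real part would force the imaginary part to vanish, and then a real
    square would equal -1.\<close>
  have "qRe I = 0"
  proof (rule ccontr)
    assume "qRe I \<noteq> 0"
    then have "qRe I * qRe I = -1" using eq by simp
    then show False by (metis not_one_le_zero neg_0_le_iff_le zero_le_square)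
  qed
  with eq show "qRe I = 0 \<and> (qIm1 I)\<^sup>2 + (qIm2 I)\<^sup>2 + (qIm3 I)\<^sup>2 = 1"
    by (simp add: power2_eq_square)
next
  assume "qRe I = 0 \<and> (qIm1 I)\<^sup>2 + (qIm2 I)\<^sup>2 + (qIm3 I)\<^sup>2 = 1"
  then show "I \<in> imag_units"
    by (simp add: imag_units_def power2_eq_square quat_eq_iff algebra_simps)
qed

lemma imag_units_square: "I \<in> imag_units \<Longrightarrow> I * I = -1"
  by (simp add: imag_units_def power2_eq_square)

lemma norm_imag_unit: "I \<in> imag_units \<Longrightarrow> norm I = 1"
  by (simp add: imag_units_iff norm_quat_eq add.assoc)

lemma uminus_imag_units: "I \<in> imag_units \<Longrightarrow> - I \<in> imag_units"
  by (simp add: imag_units_def)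

lemma imag_units_nonempty: "imag_units \<noteq> {}"
proof -
  have "Quat 0 1 0 0 \<in> imag_units" by (simp add: imag_units_iff)
  then show ?thesis by blast
qed

section \<open>Slices as embedded copies of the complex plane\<close>

definition slice_embed :: "quat \<Rightarrow> complex \<Rightarrow> quat" where
  "slice_embed I z = of_real (Re z) + I * of_real (Im z)"

lemma slice_embed_of_real [simp]: "slice_embed I (of_real r) = of_real r"
  by (simp add: slice_embed_def)

lemma slice_embed_0 [simp]: "slice_embed I 0 = 0"
  by (simp add: slice_embed_def)

lemma slice_embed_1 [simp]: "slice_embed I 1 = 1"
  by (simp add: slice_embed_def)

lemma slice_embed_add: "slice_embed I (z + w) = slice_embed I z + slice_embed I w"
  by (simp add: slice_embed_def algebra_simps)

lemma slice_embed_diff: "slice_embed I (z - w) = slice_embed I z - slice_embed I w"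
  by (simp add: slice_embed_def algebra_simps)

lemma slice_embed_cnj: "slice_embed I (cnj z) = slice_embed (- I) z"
  by (simp add: slice_embed_def)

lemma slice_embed_i: "slice_embed I \<i> = I"
  by (simp add: slice_embed_def)

lemma slice_embed_mult:
  assumes "I \<in> imag_units"
  shows "slice_embed I (z * w) = slice_embed I z * slice_embed I w"
proof -
  have "I * of_real a * (I * of_real b) = - of_real (a * b)" for a b
  proof -
    have "I * of_real a * (I * of_real b) = I * I * of_real (a * b)"
      by (simp add: of_real_def)
    then show ?thesis using imag_units_square[OF assms] by simp
  qed
  then show ?thesis
    by (simp add: slice_embed_def distrib_left distrib_right)
       (simp add: of_real_def algebra_simps)
qed

lemma slice_embed_power:
  "I \<in> imag_units \<Longrightarrow> slice_embed I (z ^ n) = slice_embed I z ^ n"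
  by (induction n) (simp_all add: slice_embed_mult)

lemma norm_slice_embed:
  assumes "I \<in> imag_units"
  shows "norm (slice_embed I z) = cmod z"
  using assms unfolding imag_units_iff
  by (simp add: slice_embed_def norm_quat_eq cmod_def power_mult_distrib add.assoc flip: distrib_right)

lemma slice_embed_eq_0_iff: "I \<in> imag_units \<Longrightarrow> slice_embed I z = 0 \<longleftrightarrow> z = 0"
  using norm_slice_embed[of I z] by force

lemma slice_embed_inverse:
  assumes "I \<in> imag_units"
  shows "slice_embed I (inverse z) = inverse (slice_embed I z)"
proof (cases "z = 0")
  case False
  then have "slice_embed I z * slice_embed I (inverse z) = 1"
    using assms by (simp flip: slice_embed_mult)
  then show ?thesis by (metis inverse_unique)
qed simp

lemma slice_embed_power_int:
  assumes "I \<in> imag_units"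
  shows "slice_embed I (z powi n) = slice_embed I z powi n"
  using assms by (simp add: power_int_def slice_embed_power slice_embed_inverse)

lemma bounded_linear_slice_embed: "bounded_linear (slice_embed I)"
proof -
  have "bounded_linear (\<lambda>z. Re z *\<^sub>R 1 + Im z *\<^sub>R I)"
    by (intro bounded_linear_intros bounded_linear_Re bounded_linear_Im)
  also have "(\<lambda>z. Re z *\<^sub>R 1 + Im z *\<^sub>R I) = slice_embed I"
    by (auto simp: slice_embed_def of_real_def)
  finally show ?thesis .
qed

lemma slice_embed_sum: "slice_embed I (\<Sum>i\<in>A. f i) = (\<Sum>i\<in>A. slice_embed I (f i))"
  by (rule linear_sum) (rule bounded_linear.linear[OF bounded_linear_slice_embed])

lemma slice_plane_eq: "slice_plane I = range (slice_embed I)"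
proof
  show "range (slice_embed I) \<subseteq> slice_plane I"
    by (auto simp: slice_plane_def slice_embed_def)
  show "slice_plane I \<subseteq> range (slice_embed I)"
  proof
    fix q assume "q \<in> slice_plane I"
    then obtain x y where "q = slice_embed I (Complex x y)"
      by (auto simp: slice_plane_def slice_embed_def)
    then show "q \<in> range (slice_embed I)" by simp
  qed
qed

lemma qsphere_eq: "qsphere x y = (\<lambda>I. slice_embed I (Complex x y)) ` imag_units"
  by (auto simp: qsphere_def slice_embed_def of_real_quat_commute)

text \<open>The representative in the closed upper half-plane, which removes the ambiguity between
  \<open>(I, z)\<close> and \<open>(- I, cnj z)\<close>.\<close>

definition slice_coord :: "quat \<Rightarrow> complex" where
  "slice_coord q = Complex (qRe q) (norm (q - of_real (qRe q)))"

text \<open>This is \<open>0\<close>, not an imaginary unit, at real \<open>q\<close>.\<close>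

definition slice_unit :: "quat \<Rightarrow> quat" where
  "slice_unit q = sgn (q - of_real (qRe q))"

lemma slice_embed_imag:
  assumes "I \<in> imag_units"
  shows "slice_embed I z - of_real (qRe (slice_embed I z)) = Im z *\<^sub>R I"
  using assms by (simp add: slice_embed_def imag_units_iff of_real_def)

lemma qRe_slice_embed: "I \<in> imag_units \<Longrightarrow> qRe (slice_embed I z) = Re z"
  by (simp add: slice_embed_def imag_units_iff)

lemma slice_coord_embed:
  assumes "I \<in> imag_units"
  shows "slice_coord (slice_embed I z) = (if Im z \<ge> 0 then z else cnj z)"
proof -
  have "norm (slice_embed I z - of_real (qRe (slice_embed I z))) = \<bar>Im z\<bar>"
    by (simp only: slice_embed_imag[OF assms]) (simp add: norm_imag_unit[OF assms])
  then show ?thesis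
    by (simp add: slice_coord_def complex_eq_iff qRe_slice_embed[OF assms])
qed

lemma slice_unit_embed:
  assumes "I \<in> imag_units"
  shows "slice_unit (slice_embed I z) = sgn (Im z) *\<^sub>R I"
  by (simp only: slice_unit_def slice_embed_imag[OF assms])
     (simp add: sgn_scaleR sgn_div_norm norm_imag_unit[OF assms])

text \<open>The unit is the normalized imaginary part of \<open>q\<close>; at a real
  \<open>q\<close> any imaginary unit serves.\<close>

lemma ex_slice_embed: "\<exists>I\<in>imag_units. q = slice_embed I (slice_coord q)"
proof (cases "q - of_real (qRe q) = 0")
  case True
  obtain I where "I \<in> imag_units" using imag_units_nonempty by blast
  moreover have "q = slice_embed I (slice_coord q)"
    using True by (simp add: slice_embed_def slice_coord_def)
  ultimately show ?thesis by blast
next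
  case False
  define v where "v = q - of_real (qRe q)"
  have v: "v \<noteq> 0" "qRe v = 0" using False by (auto simp: v_def)
  have n: "(norm v)\<^sup>2 = (qIm1 v)\<^sup>2 + (qIm2 v)\<^sup>2 + (qIm3 v)\<^sup>2"
    using v by (simp add: norm_quat_eq)
  have "(qIm1 v / norm v)\<^sup>2 + (qIm2 v / norm v)\<^sup>2 + (qIm3 v / norm v)\<^sup>2 = (norm v)\<^sup>2 / (norm v)\<^sup>2"
    by (simp add: power_divide n flip: add_divide_distrib)
  then have "sgn v \<in> imag_units"
    using v by (simp add: imag_units_iff sgn_div_norm divide_inverse mult.commute)
  moreover have "sgn v * of_real (norm v) = v"
    using v by (simp add: sgn_div_norm of_real_def)
  then have "q = slice_embed (sgn v) (slice_coord q)"
    by (simp add: slice_embed_def slice_coord_def flip: v_def) (simp add: v_def)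
  ultimately show ?thesis by blast
qed

lemma continuous_on_slice_coord: "continuous_on S slice_coord"
proof -
  have "qRe q = inner q 1" for q by (simp add: inner_quat_def)
  then have "slice_coord = (\<lambda>q. of_real (inner q 1) + \<i> * of_real (norm (q - of_real (inner q 1))))"
    by (auto simp: slice_coord_def complex_eq_iff)
  moreover have "continuous_on S (\<lambda>q::quat. of_real (inner q 1) + \<i> * of_real (norm (q - of_real (inner q 1))))"
    by (intro continuous_intros)
  ultimately show ?thesis by metis
qed

section \<open>Rotation of plane sets into the quaternions\<close>

definition circularization :: "complex set \<Rightarrow> quat set" where
  "circularization W = {q. slice_coord q \<in> W}"

text \<open>\<open>circularization\<close> tests only the representative in the closed upper
  half-plane; the conjugation symmetry of \<open>W\<close> takes care of the lower one.\<close>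

lemma slice_embed_in_circularization:
  assumes "I \<in> imag_units" "\<forall>z\<in>W. cnj z \<in> W"
  shows "slice_embed I z \<in> circularization W \<longleftrightarrow> z \<in> W"
  using bspec[OF assms(2), of z] bspec[OF assms(2), of "cnj z"]
  by (auto simp: circularization_def slice_coord_embed[OF assms(1)])

lemma open_circularization: "open W \<Longrightarrow> open (circularization W)"
  using open_vimage[of W slice_coord] continuous_on_slice_coord
  by (simp add: circularization_def vimage_def)

lemma circularization_mono: "V \<subseteq> W \<Longrightarrow> circularization V \<subseteq> circularization W"
  by (auto simp: circularization_def)

lemma circularization_slice:
  assumes "I \<in> imag_units" "\<forall>z\<in>W. cnj z \<in> W"
  shows "circularization W \<inter> slice_plane I = slice_embed I ` W"
  using slice_embed_in_circularization[OF assms] by (auto simp: slice_plane_eq)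

lemma circularization_eq_Union:
  assumes "\<forall>z\<in>W. cnj z \<in> W"
  shows "circularization W = (\<Union>I\<in>imag_units. slice_embed I ` W)"
  using slice_embed_in_circularization[OF _ assms] ex_slice_embed
  by (auto simp: circularization_def) blast+

lemma qsphere_eq_circularization:
  "qsphere x y = circularization {Complex x y, Complex x (- y)}"
proof -
  have "slice_embed I (Complex x (- y)) = slice_embed (- I) (Complex x y)" for I
    by (simp add: slice_embed_def)
  then show ?thesis
    by (subst circularization_eq_Union) (auto simp: qsphere_eq complex_eq_iff uminus_imag_units)
qed

text \<open>Every slice is a continuous image of the connected set \<open>W\<close>, and all slices
  share the real point \<open>r\<close>, so their union is connected.\<close>

lemma symmetric_slice_domain_circularization:
  assumes W: "open W" "connected W" "\<forall>z\<in>W. cnj z \<in> W" "of_real r \<in> W"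
  shows "symmetric_slice_domain (circularization W)"
proof -
  have conn: "connected (slice_embed I ` W)" for I
    using W(2) bounded_linear_slice_embed[of I]
    by (intro connected_continuous_image linear_continuous_on)
  have r: "of_real r \<in> slice_embed I ` W" for I
    using W(4) by (metis imageI slice_embed_of_real)
  have "connected (circularization W)"
    unfolding circularization_eq_Union[OF W(3)]
  proof (rule connected_Union)
    show "(\<Inter>I\<in>imag_units. slice_embed I ` W) \<noteq> {}" using r by blast
  qed (use conn in blast)
  moreover have "open (circularization W)" using W by (simp add: open_circularization)
  moreover have "of_real r \<in> circularization W" using r imag_units_nonempty
    by (subst circularization_eq_Union[OF W(3)]) blast+
  moreover have "axially_symmetric (circularization W)"
    unfolding axially_symmetric_def
  proof (intro equalityI subsetI)
    fix q assume q: "q \<in> circularization W"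
    then obtain I where I: "I \<in> imag_units" "q = slice_embed I (slice_coord q)"
      using ex_slice_embed by blast
    define z where "z = slice_coord q"
    have "of_real (Re z) + I * of_real (Im z) \<in> circularization W"
      using q I by (simp add: z_def slice_embed_def)
    moreover have "q \<in> qsphere (Re z) (Im z)"
      using I by (auto simp: qsphere_eq z_def)
    ultimately show "q \<in> \<Union> {qsphere x y |x y I. I \<in> imag_units \<and> of_real x + I * of_real y \<in> circularization W}"
      using I by blast
  next
    fix q assume "q \<in> \<Union> {qsphere x y |x y I. I \<in> imag_units \<and> of_real x + I * of_real y \<in> circularization W}"
    then obtain x y I J where *: "I \<in> imag_units" "of_real x + I * of_real y \<in> circularization W"
      "J \<in> imag_units" "q = slice_embed J (Complex x y)"
      by (auto simp: qsphere_eq)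
    then have "slice_embed I (Complex x y) \<in> circularization W" by (simp add: slice_embed_def)
    then show "q \<in> circularization W"
      using * slice_embed_in_circularization[OF _ W(3)] by simp
  qed
  ultimately show ?thesis
    unfolding symmetric_slice_domain_def slice_domain_def
    using W conn by (auto simp: circularization_slice Reals_def)
      (metis circularization_slice openin_open_Int Int_commute)+
qed

text \<open>\<open>W\<close> is read off from one slice; axial symmetry makes every other slice give
  the same set, and comparing \<open>I\<close> with \<open>- I\<close> gives the conjugation
  symmetry.\<close>

lemma symmetric_slice_domainE:
  assumes "symmetric_slice_domain \<Omega>"
  obtains W r where "\<Omega> = circularization W" "open W" "connected W"
    "\<forall>z\<in>W. cnj z \<in> W" "of_real r \<in> W"
proof -
  obtain I where I: "I \<in> imag_units" using imag_units_nonempty by blast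
  define W where "W = {z. slice_embed I z \<in> \<Omega>}"
  have sym: "slice_embed K z \<in> \<Omega>" if "slice_embed J z \<in> \<Omega>" "J \<in> imag_units" "K \<in> imag_units" for J K z
  proof -
    have "slice_embed K z \<in> qsphere (Re z) (Im z)" using that by (auto simp: qsphere_eq)
    moreover have "of_real (Re z) + J * of_real (Im z) \<in> \<Omega>" using that by (simp add: slice_embed_def)
    ultimately show ?thesis
      using assms that(2) unfolding symmetric_slice_domain_def axially_symmetric_def by blast
  qed
  have W: "slice_embed J z \<in> \<Omega> \<longleftrightarrow> z \<in> W" if "J \<in> imag_units" for J z
    using sym that I by (auto simp: W_def)
  have cnj: "\<forall>z\<in>W. cnj z \<in> W"
    using I W[OF uminus_imag_units[OF I]] by (simp add: W_def slice_embed_cnj)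
  have eq: "\<Omega> = circularization W"
  proof (intro set_eqI)
    fix q
    obtain J where "J \<in> imag_units" "q = slice_embed J (slice_coord q)"
      using ex_slice_embed by blast
    then show "q \<in> \<Omega> \<longleftrightarrow> q \<in> circularization W"
      using W slice_embed_in_circularization[OF _ cnj] by metis
  qed
  have "open \<Omega>" using assms by (simp add: symmetric_slice_domain_def slice_domain_def)
  then have oW: "open W"
    using open_vimage[of \<Omega> "slice_embed I"]
      linear_continuous_on[OF bounded_linear_slice_embed[of I]] by (simp add: W_def vimage_def)
  have "connected (slice_embed I ` W)"
    using assms I unfolding symmetric_slice_domain_def slice_domain_def eq
    by (simp flip: circularization_slice[OF I cnj])
  \<comment> \<open>This linear map inverts \<open>slice_embed I\<close> on its slice and so
    transports connectedness back to \<open>W\<close>.\<close>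
  moreover have "linear (\<lambda>q. Complex (qRe q) (inner q I))"
    by (rule linearI) (simp_all add: complex_eq_iff inner_add_left)
  then have "continuous_on (slice_embed I ` W) (\<lambda>q. Complex (qRe q) (inner q I))"
    by (intro linear_continuous_on) (rule linear_conv_bounded_linear[THEN iffD1])
  ultimately have "connected ((\<lambda>q. Complex (qRe q) (inner q I)) ` slice_embed I ` W)"
    by (rule connected_continuous_image[rotated])
  moreover have "inner (slice_embed I z) I = Im z" for z
  proof -
    have "inner I I = 1" using norm_imag_unit[OF I] by (simp add: norm_eq_1)
    moreover have "inner 1 I = 0" using I by (simp add: inner_quat_def imag_units_iff)
    ultimately show ?thesis by (simp add: slice_embed_def inner_add_left of_real_def)
  qed
  then have "(\<lambda>q. Complex (qRe q) (inner q I)) ` slice_embed I ` W = W"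
    using qRe_slice_embed[OF I] by (simp add: image_image)
  ultimately have cW: "connected W" by simp
  obtain r where "of_real r \<in> \<Omega>"
    using assms unfolding symmetric_slice_domain_def slice_domain_def Reals_def by blast
  then have "of_real r \<in> W" using W[OF I, of "of_real r"] by simp
  then show ?thesis using that eq oW cW cnj by blast
qed

section \<open>Functions induced by stems\<close>

text \<open>A stem takes values in the complexification of the quaternions; it is given by its
  complex coordinates with respect to the real basis.\<close>

definition stem_value :: "quat \<Rightarrow> (quat \<Rightarrow> complex) \<Rightarrow> quat" where
  "stem_value I v = (\<Sum>b\<in>Basis. slice_embed I (v b) * b)"

definition stem_fun :: "(quat \<Rightarrow> complex \<Rightarrow> complex) \<Rightarrow> quat \<Rightarrow> quat" where
  "stem_fun G q = stem_value (slice_unit q) (\<lambda>b. G b (slice_coord q))"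

text \<open>This symmetry makes the induced value at a point independent of writing it as
  \<open>slice_embed I z\<close> or as \<open>slice_embed (- I) (cnj z)\<close>.\<close>

definition intrinsic :: "(quat \<Rightarrow> complex \<Rightarrow> complex) \<Rightarrow> bool" where
  "intrinsic G \<longleftrightarrow> (\<forall>b z. G b (cnj z) = cnj (G b z))"

lemma stem_value_mult:
  "I \<in> imag_units \<Longrightarrow> stem_value I (\<lambda>b. t * v b) = slice_embed I t * stem_value I v"
  by (simp add: stem_value_def slice_embed_mult sum_distrib_left mult.assoc)

lemma stem_value_add: "stem_value I (\<lambda>b. v b + w b) = stem_value I v + stem_value I w"
  by (simp add: stem_value_def slice_embed_add distrib_right sum.distrib)

lemma stem_value_sum: "stem_value I (\<lambda>b. \<Sum>i\<in>A. v i b) = (\<Sum>i\<in>A. stem_value I (v i))"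
  unfolding stem_value_def slice_embed_sum sum_distrib_right by (rule sum.swap)

lemma stem_value_of_real: "stem_value I (\<lambda>b. of_real (inner c b)) = c"
proof -
  have "stem_value I (\<lambda>b. of_real (inner c b)) = (\<Sum>b\<in>Basis. inner c b *\<^sub>R b)"
    unfolding stem_value_def slice_embed_of_real by (simp add: of_real_def)
  then show ?thesis by (simp add: euclidean_representation)
qed

lemma stem_fun_embed:
  assumes "intrinsic G" "I \<in> imag_units"
  shows "stem_fun G (slice_embed I z) = stem_value I (\<lambda>b. G b z)"
proof -
  have "slice_embed (slice_unit (slice_embed I z)) (G b (slice_coord (slice_embed I z))) = slice_embed I (G b z)" for b
  proof -
    have G: "G b (cnj z) = cnj (G b z)" using assms by (simp add: intrinsic_def)
    consider "Im z > 0" | "Im z < 0" | "Im z = 0" by linarith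
    then show ?thesis
    proof cases
      \<comment> \<open>At a real point \<open>slice_unit\<close> is \<open>0\<close> instead of an
        imaginary unit; this is harmless because the stem is real there and its imaginary part drops
        out.\<close>
      case 3
      then have "cnj z = z" by (simp add: complex_eq_iff)
      then have "Im (G b z) = 0" using G by (metis cnj.simps(2) equal_neg_zero)
      then show ?thesis
        using 3 by (simp add: slice_coord_embed[OF assms(2)]) (simp add: slice_embed_def)
    qed (simp_all add: slice_coord_embed[OF assms(2)] slice_unit_embed[OF assms(2)] G slice_embed_cnj)
  qed
  then show ?thesis by (simp add: stem_fun_def stem_value_def)
qed

lemma has_sum_finite_sum:
  fixes f :: "'a \<Rightarrow> 'b \<Rightarrow> 'c :: real_normed_vector"
  assumes "finite B" "\<And>b. b \<in> B \<Longrightarrow> ((\<lambda>n. f n b) has_sum s b) A"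
  shows "((\<lambda>n. \<Sum>b\<in>B. f n b) has_sum (\<Sum>b\<in>B. s b)) A"
  using assms by (induction B rule: finite_induct) (auto intro!: has_sum_add)

lemma bounded_linear_stem_component: "bounded_linear (\<lambda>z. slice_embed I z * b)"
  using bounded_linear_compose[OF bounded_linear_mult_left bounded_linear_slice_embed] by (simp add: o_def)

lemma has_sum_stem_value:
  assumes "\<And>b. b \<in> Basis \<Longrightarrow> ((\<lambda>n. f n b) has_sum v b) A"
  shows "((\<lambda>n. stem_value I (f n)) has_sum stem_value I v) A"
  unfolding stem_value_def
  by (intro has_sum_finite_sum has_sum_bounded_linear[OF bounded_linear_stem_component] assms) auto

lemma sums_stem_value:
  assumes "\<And>b. b \<in> Basis \<Longrightarrow> (\<lambda>n. f n b) sums v b"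
  shows "(\<lambda>n. stem_value I (f n)) sums stem_value I v"
  unfolding stem_value_def
  by (intro sums_sum bounded_linear.sums[OF bounded_linear_stem_component] assms)

text \<open>On the slice of \<open>I\<close> multiplying all coordinates of a stem by \<i> amounts
  to multiplying its value by \<open>I\<close> from the left, so the complex differentiability of
  the coordinates becomes the Cauchy-Riemann equation.\<close>

lemma slice_regular_stem_fun:
  assumes W: "open W" "\<forall>z\<in>W. cnj z \<in> W"
    and G: "intrinsic G" "\<And>b. b \<in> Basis \<Longrightarrow> G b holomorphic_on W"
  shows "slice_regular_on (circularization W) (stem_fun G)"
  unfolding slice_regular_on_def
proof (intro ballI allI impI)
  fix I x y assume I: "I \<in> imag_units" and xy: "of_real x + I * of_real y \<in> circularization W"
  define z where "z = Complex x y"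
  have "of_real x + I * of_real y = slice_embed I z" by (simp add: z_def slice_embed_def)
  then have z: "z \<in> W" using xy slice_embed_in_circularization[OF I W(2)] by simp
  have eq: "(\<lambda>(s, t). stem_fun G (of_real s + I * of_real t)) =
      (\<lambda>p. \<Sum>b\<in>Basis. slice_embed I (G b (Complex (fst p) (snd p))) * b)"
  proof
    fix p :: "real \<times> real"
    have "of_real (fst p) + I * of_real (snd p) = slice_embed I (Complex (fst p) (snd p))"
      by (simp add: slice_embed_def)
    then show "(case p of (s, t) \<Rightarrow> stem_fun G (of_real s + I * of_real t)) =
        (\<Sum>b\<in>Basis. slice_embed I (G b (Complex (fst p) (snd p))) * b)"
      using stem_fun_embed[OF G(1) I] by (simp add: case_prod_beta stem_value_def)
  qed
  have C: "((\<lambda>p. Complex (fst p) (snd p)) has_derivative (\<lambda>p. Complex (fst p) (snd p))) (at (x, y))"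
  proof -
    have "((\<lambda>p. of_real (fst p) + \<i> * of_real (snd p) :: complex) has_derivative
        (\<lambda>p. of_real (fst p) + \<i> * of_real (snd p))) (at (x, y))"
      by (auto intro!: derivative_eq_intros)
    then show ?thesis by (simp add: Complex_eq)
  qed
  define f' where "f' = (\<lambda>p. stem_value I (\<lambda>b. deriv (G b) z * Complex (fst p) (snd p)))"
  have "((\<lambda>p. slice_embed I (G b (Complex (fst p) (snd p))) * b) has_derivative
      (\<lambda>p. slice_embed I (deriv (G b) z * Complex (fst p) (snd p)) * b)) (at (x, y))" if "b \<in> Basis" for b
  proof -
    have "(G b has_field_derivative deriv (G b) z) (at z)"
      using G(2)[OF that] W(1) z holomorphic_derivI by blast
    then have "(G b has_derivative (\<lambda>h. deriv (G b) z * h)) (at (Complex (fst (x, y)) (snd (x, y))))"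
      by (simp add: has_field_derivative_def z_def)
    from has_derivative_compose[OF C this]
    have "((\<lambda>p. G b (Complex (fst p) (snd p))) has_derivative
      (\<lambda>p. deriv (G b) z * Complex (fst p) (snd p))) (at (x, y))" .
    from bounded_linear.has_derivative[OF bounded_linear_stem_component this]
    show ?thesis .
  qed
  then have "((\<lambda>(s, t). stem_fun G (of_real s + I * of_real t)) has_derivative f') (at (x, y))"
    unfolding eq f'_def stem_value_def by (rule has_derivative_sum)
  moreover have "f' (1, 0) + I * f' (0, 1) = 0"
  proof -
    have "f' (0, 1) = stem_value I (\<lambda>b. \<i> * deriv (G b) z)"
      by (simp add: f'_def mult.commute flip: imaginary_unit.code)
    also have "\<dots> = I * f' (1, 0)"
      by (simp add: f'_def stem_value_mult[OF I] slice_embed_i flip: one_complex.code)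
    finally have "I * f' (0, 1) = (I * I) * f' (1, 0)" by (simp add: mult.assoc)
    then show ?thesis using imag_units_square[OF I] by simp
  qed
  ultimately show "\<exists>f'. ((\<lambda>(s, t). stem_fun G (of_real s + I * of_real t)) has_derivative f') (at (x, y)) \<and>
      (1/2) *\<^sub>R (f' (1, 0) + I * f' (0, 1)) = 0"
    by (intro exI[of _ f'] conjI) auto
qed

section \<open>Singularities of functions induced by stems\<close>

lemma not_qpole_regular:
  assumes "open D" "slice_regular_on D f" "p \<in> D"
  shows "\<not> qpole D f p"
proof
  assume p: "qpole D f p"
  \<comment> \<open>A pole carries Laurent expansions, hence is a singularity; \<open>f\<close> on
    \<open>D\<close> is then its own regular extension, which makes it removable.\<close>
  then have "singularity D f p" unfolding qpole_def singularity_def by blast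
  then have "removable_singularity D f p"
    unfolding removable_singularity_def using assms by blast
  with p show False by (simp add: qpole_def)
qed

text \<open>The Taylor series of the numerator is divided by \<open>(w - z) ^ m\<close> and its
  index shifted by \<open>m\<close>; absolute convergence turns it into unconditional summability
  over the integers.\<close>

lemma meromorphic_at_laurent_series:
  assumes "f meromorphic_on {z}"
  obtains r c and m :: nat where "r > 0" "\<And>k. k > m \<Longrightarrow> c (- int k) = 0"
    "\<And>w. 0 < norm (w - z) \<Longrightarrow> norm (w - z) < r \<Longrightarrow> ((\<lambda>n. (w - z) powi n * c n) has_sum f w) UNIV"
proof -
  obtain m h where h: "h analytic_on {z}" and f: "\<forall>\<^sub>F w in at z. f w = h w / (w - z) ^ m"
    using meromorphic_at_imp_quotient[OF assms] .
  obtain r1 where r1: "r1 > 0" "h holomorphic_on ball z r1"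
    using h by (auto simp: analytic_on_def)
  obtain r2 where r2: "r2 > 0" "\<And>w. w \<noteq> z \<Longrightarrow> dist w z < r2 \<Longrightarrow> f w = h w / (w - z) ^ m"
    using f by (auto simp: eventually_at)
  define d where "d = (\<lambda>k. (deriv ^^ k) h z / fact k)"
  define c where "c = (\<lambda>n. if n < - int m then 0 else d (nat (n + int m)))"
  have sums: "(\<lambda>k. d k * (w - z) ^ k) sums h w" if "norm (w - z) < r1" for w
    using holomorphic_power_series[OF r1(2), of w] that
    by (simp add: d_def dist_norm norm_minus_commute)
  show ?thesis
  proof (rule that[of "min r1 r2" m c])
    show "min r1 r2 > 0" using r1 r2 by simp
    show "c (- int k) = 0" if "k > m" for k using that by (simp add: c_def)
    fix w assume w: "0 < norm (w - z)" "norm (w - z) < min r1 r2"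
    \<comment> \<open>Convergence at the larger modulus \<open>t\<close> gives absolute convergence
      at \<open>w\<close>.\<close>
    obtain t where t: "norm (w - z) < t" "t < r1" using w dense[of "norm (w - z)" r1] by auto
    have "t > 0" using w t by linarith
    then have "summable (\<lambda>k. d k * (of_real t) ^ k)"
      using sums[of "z + of_real t"] t by (simp add: sums_iff)
    then have "summable (\<lambda>k. norm (d k * (w - z) ^ k))"
      by (rule powser_insidea) (use t in auto)
    then have "((\<lambda>k. d k * (w - z) ^ k) has_sum h w) UNIV"
      by (rule norm_summable_imp_has_sum) (use sums w in auto)
    then have "((\<lambda>k. (1 / (w - z) ^ m) * (d k * (w - z) ^ k)) has_sum (1 / (w - z) ^ m) * h w) UNIV"
      by (rule has_sum_cmult_right)
    moreover have "(1 / (w - z) ^ m) * h w = f w"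
      using r2(2)[of w] w by (simp add: dist_norm)
    moreover have "(1 / (w - z) ^ m) * (d k * (w - z) ^ k) =
        ((\<lambda>n. (w - z) powi n * c n) \<circ> (\<lambda>k. int k - int m)) k" for k
    proof -
      have "(w - z) powi (int k - int m) = (w - z) ^ k / (w - z) ^ m"
        using w by (simp add: power_int_diff)
      then show ?thesis by (simp add: c_def)
    qed
    ultimately have "(((\<lambda>n. (w - z) powi n * c n) \<circ> (\<lambda>k. int k - int m)) has_sum f w) UNIV"
      by (simp only:)
    then have "((\<lambda>n. (w - z) powi n * c n) has_sum f w) (range (\<lambda>k. int k - int m))"
      by (subst has_sum_reindex) (auto simp: inj_on_def)
    moreover have "c n = 0" if "n \<notin> range (\<lambda>k. int k - int m)" for n
    proof (rule ccontr)
      assume "c n \<noteq> 0"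
      then have "n = int (nat (n + int m)) - int m" by (auto simp: c_def split: if_splits)
      then show False using that by blast
    qed
    ultimately show "((\<lambda>n. (w - z) powi n * c n) has_sum f w) UNIV"
      by (subst (asm) has_sum_cong_neutral[where T = UNIV and g = "\<lambda>n. (w - z) powi n * c n"]) auto
  qed
qed

text \<open>The expansions of the coordinates share the powers of \<open>w - z\<close>, which pass
  to the left of the stem value, so they combine into one expansion with quaternionic coefficients
  on the right. As the basis is finite, a common radius and a common bound on the pole orders
  exist.\<close>

lemma laurent_expansion_stem_fun:
  assumes W: "\<forall>z\<in>W. cnj z \<in> W" and I: "I \<in> imag_units"
    and z: "r > 0" "ball z r - {z} \<subseteq> W"
    and G: "intrinsic G" "\<And>b. b \<in> Basis \<Longrightarrow> G b meromorphic_on {z}"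
  shows "\<exists>R a. Defs.laurent_expansion (circularization W) (stem_fun G) (slice_embed I z) I R a \<and>
           (\<exists>m::nat. \<forall>k>m. a (- int k) = 0)"
proof -
  define Q where "Q = (\<lambda>b (\<rho>::real) c (m::nat). \<rho> > 0 \<and> (\<forall>k>m. c (- int k) = 0) \<and>
    (\<forall>w. 0 < norm (w - z) \<longrightarrow> norm (w - z) < \<rho> \<longrightarrow> ((\<lambda>n. (w - z) powi n * c n) has_sum G b w) UNIV))"
  have "\<exists>\<rho> c m. Q b \<rho> c m" if "b \<in> Basis" for b
    using meromorphic_at_laurent_series[OF G(2)[OF that]] unfolding Q_def by metis
  then obtain \<rho> c m where Q: "\<And>b. b \<in> Basis \<Longrightarrow> Q b (\<rho> b) (c b) (m b)"
    by metis
  have \<rho>: "\<rho> b > 0" and c: "\<And>k. k > m b \<Longrightarrow> c b (- int k) = 0"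
    and s: "\<And>w. 0 < norm (w - z) \<Longrightarrow> norm (w - z) < \<rho> b \<Longrightarrow>
       ((\<lambda>n. (w - z) powi n * c b n) has_sum G b w) UNIV" if "b \<in> Basis" for b
    using Q[OF that] by (auto simp: Q_def)
  define R where "R = Min (insert r (\<rho> ` Basis))"
  define a where "a = (\<lambda>n. stem_value I (\<lambda>b. c b n))"
  have R: "R > 0" "R \<le> r"
    using \<rho> z by (auto simp: R_def)
  have R\<rho>: "R \<le> \<rho> b" if "b \<in> Basis" for b
    unfolding R_def using that by (intro Min_le) auto
  have "Defs.laurent_expansion (circularization W) (stem_fun G) (slice_embed I z) I R a"
    unfolding Defs.laurent_expansion_def
  proof (intro conjI ballI impI)
    show "R > 0" by (rule R)
    fix q assume "q \<in> slice_plane I" and q: "0 < norm (q - slice_embed I z) \<and> norm (q - slice_embed I z) < R"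
    then obtain w where w: "q = slice_embed I w" by (auto simp: slice_plane_eq)
    have qw: "q - slice_embed I z = slice_embed I (w - z)" by (simp add: w slice_embed_diff)
    then have wz: "0 < norm (w - z)" "norm (w - z) < R"
      using q by (simp_all add: norm_slice_embed[OF I])
    then have "w \<in> W" using z R by (auto simp: dist_norm norm_minus_commute)
    then show "q \<in> circularization W" using slice_embed_in_circularization[OF I W] w by simp
    have "((\<lambda>n. stem_value I (\<lambda>b. (w - z) powi n * c b n)) has_sum stem_value I (\<lambda>b. G b w)) UNIV"
      by (rule has_sum_stem_value) (use s wz R\<rho> in force)
    then show "((\<lambda>n. (q - slice_embed I z) powi n * a n) has_sum stem_fun G q) UNIV"
      by (simp add: w stem_fun_embed[OF G(1) I] stem_value_mult[OF I] slice_embed_power_int[OF I] a_def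
          flip: slice_embed_diff)
  qed
  moreover have "\<forall>k>Max (m ` Basis). a (- int k) = 0"
    using c by (auto simp: a_def stem_value_def intro!: sum.neutral)
  ultimately show ?thesis by blast
qed

lemma sparse_punctured_ball:
  fixes U Z :: "complex set"
  assumes "open U" "Z sparse_in U" "z \<in> U"
  obtains r where "r > 0" "ball z r - {z} \<subseteq> U - Z"
proof -
  have "\<forall>\<^sub>F w in at z. w \<notin> Z" using assms sparse_in_eventually_iff by blast
  moreover have "\<forall>\<^sub>F w in at z. w \<in> U" using assms by (intro eventually_at_in_open')
  ultimately have "\<forall>\<^sub>F w in at z. w \<in> U - Z" by eventually_elim auto
  then obtain r where "r > 0" "\<And>w. w \<noteq> z \<Longrightarrow> dist w z < r \<Longrightarrow> w \<in> U - Z"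
    by (auto simp: eventually_at)
  then show ?thesis using that by (metis Diff_iff dist_commute insertCI mem_ball subsetI)
qed

text \<open>A sparse set does not disconnect a plane domain. A real point survives because the
  removed set is countable while the real interval around \<open>r\<close> is not.\<close>

lemma symmetric_slice_domain_minus_sparse:
  assumes U: "open U" "connected U" "\<forall>z\<in>U. cnj z \<in> U" "of_real r \<in> U"
    and Z: "Z sparse_in U" "\<forall>z\<in>Z. cnj z \<in> Z"
  shows "symmetric_slice_domain (circularization (U - Z))"
proof -
  have "open (U - Z)" using U Z by (intro open_diff_sparse_pts)
  moreover have "connected (U - Z)" using U Z by (intro sparse_imp_connected) auto
  moreover have "\<forall>z\<in>U - Z. cnj z \<in> U - Z" using U(3) Z(2) by (metis Diff_iff complex_cnj_cnj)
  moreover obtain t where "of_real t \<in> U - Z"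
  proof -
    obtain e where e: "e > 0" "ball (of_real r) e \<subseteq> U" using U by (meson openE)
    have "countable (U \<inter> Z)" using sparse_imp_countable[OF U(1) Z(1)] .
    then have "countable ((of_real :: real \<Rightarrow> complex) ` (of_real -` (U \<inter> Z)))"
      by (rule countable_subset[rotated]) auto
    then have "countable ((of_real :: real \<Rightarrow> complex) -` (U \<inter> Z))"
      by (rule countable_image_inj_on) (auto simp: inj_on_def)
    moreover have "uncountable {r - e<..<r + e}" using e(1) uncountable_open_interval by simp
    ultimately have "\<not> {r - e<..<r + e} \<subseteq> of_real -` (U \<inter> Z :: complex set)"
      by (metis countable_subset)
    then obtain t where t: "t \<in> {r - e<..<r + e}" "of_real t \<notin> U \<inter> Z" by blast
    have "(of_real t :: complex) \<in> ball (of_real r) e"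
      using t by (auto simp: dist_norm simp flip: of_real_diff)
    then show ?thesis using that t e by blast
  qed
  ultimately show ?thesis by (rule symmetric_slice_domain_circularization)
qed

text \<open>Once a Laurent expansion with finitely many negative terms exists in every slice through
  a point, that point is a pole or removable by definition.\<close>

lemma semiregular_stem_fun:
  assumes U: "open U" "connected U" "\<forall>z\<in>U. cnj z \<in> U" "of_real r \<in> U"
    and Z: "Z \<subseteq> U" "Z sparse_in U" "\<forall>z\<in>Z. cnj z \<in> Z"
    and G: "intrinsic G" "\<And>b. b \<in> Basis \<Longrightarrow> G b holomorphic_on U - Z"
      "\<And>b z. b \<in> Basis \<Longrightarrow> z \<in> Z \<Longrightarrow> G b meromorphic_on {z}"
  shows "semiregular_on (circularization U) (circularization (U - Z)) (stem_fun G)"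
  unfolding semiregular_on_def
proof (intro conjI ballI)
  have sym: "\<forall>z\<in>U - Z. cnj z \<in> U - Z" using U(3) Z(3) by (metis Diff_iff complex_cnj_cnj)
  show "symmetric_slice_domain (circularization U)"
    using U by (rule symmetric_slice_domain_circularization)
  show "symmetric_slice_domain (circularization (U - Z))"
    using U Z(2,3) by (rule symmetric_slice_domain_minus_sparse)
  show "circularization (U - Z) \<subseteq> circularization U" by (rule circularization_mono) auto
  show "slice_regular_on (circularization (U - Z)) (stem_fun G)"
    using U Z sym G by (intro slice_regular_stem_fun open_diff_sparse_pts)
  fix p assume p: "p \<in> circularization U - circularization (U - Z)"
  have "\<exists>R a. Defs.laurent_expansion (circularization (U - Z)) (stem_fun G) p I R a \<and>
      (\<exists>m::nat. \<forall>k>m. a (- int k) = 0)" if I: "I \<in> imag_units" "p \<in> slice_plane I" for I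
  proof -
    obtain z where z: "p = slice_embed I z" using I by (auto simp: slice_plane_eq)
    have "z \<in> U" "z \<in> Z"
      using p slice_embed_in_circularization[OF I(1) U(3)] slice_embed_in_circularization[OF I(1) sym]
      by (auto simp: z)
    moreover obtain r where "r > 0" "ball z r - {z} \<subseteq> U - Z"
      using sparse_punctured_ball[OF U(1) Z(2) \<open>z \<in> U\<close>] .
    ultimately show ?thesis
      unfolding z using G by (intro laurent_expansion_stem_fun[OF sym I(1)])
  qed
  then show "qpole (circularization (U - Z)) (stem_fun G) p \<or>
      removable_singularity (circularization (U - Z)) (stem_fun G) p"
    unfolding qpole_def by blast
qed

section \<open>Principal parts\<close>

lemma sphere_poly_embed:
  assumes "I \<in> imag_units"
  shows "sphere_poly x y (slice_embed I w) = slice_embed I ((w - of_real x)\<^sup>2 + (of_real y)\<^sup>2)"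
  by (simp add: sphere_poly_def slice_embed_add slice_embed_diff slice_embed_power[OF assms])

lemma sphere_nbhd_eq_circularization:
  "sphere_nbhd x y R = circularization {w. norm ((w - of_real x)\<^sup>2 + (of_real y)\<^sup>2) < R\<^sup>2}"
proof (intro set_eqI)
  fix q
  obtain I where I: "I \<in> imag_units" "q = slice_embed I (slice_coord q)"
    using ex_slice_embed by blast
  have "norm (sphere_poly x y q) = norm ((slice_coord q - of_real x)\<^sup>2 + (of_real y)\<^sup>2)"
    by (subst I(2)) (simp only: sphere_poly_embed[OF I(1)] norm_slice_embed[OF I(1)])
  then show "q \<in> sphere_nbhd x y R \<longleftrightarrow>
      q \<in> circularization {w. norm ((w - of_real x)\<^sup>2 + (of_real y)\<^sup>2) < R\<^sup>2}"
    by (simp add: sphere_nbhd_def circularization_def)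
qed

lemma sphere_poly_factor:
  "(w - of_real x)\<^sup>2 + (of_real y)\<^sup>2 = (w - Complex x y) * (w - Complex x (- y))"
  by (simp add: complex_eq_iff power2_eq_square algebra_simps)

lemma stem_value_comb:
  assumes "I \<in> imag_units"
  shows "stem_value I (\<lambda>b. t * (of_real (inner c b) + w * of_real (inner d b))) =
    slice_embed I t * (c + slice_embed I w * d)"
  by (simp add: stem_value_mult[OF assms] stem_value_add stem_value_of_real)

text \<open>Writing \<open>(q - q\<^sub>0) * c\<close> as \<open>q * c - q\<^sub>0 * c\<close>
  leaves only constant quaternions to the right of powers of \<open>q\<close>; their coordinates are
  real, so the stem is a real rational function in each coordinate.\<close>

definition principal_stem :: "real \<Rightarrow> real \<Rightarrow> quat \<Rightarrow> nat \<Rightarrow> (nat \<Rightarrow> quat) \<Rightarrow> quat \<Rightarrow> complex \<Rightarrow> complex" where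
  "principal_stem x y q\<^sub>0 m a b w = (\<Sum>n=1..m.
     (of_real (inner (a (2 * n) - q\<^sub>0 * a (2 * n + 1)) b) + w * of_real (inner (a (2 * n + 1)) b)) /
     ((w - of_real x)\<^sup>2 + (of_real y)\<^sup>2) ^ n)"

lemma principal_stem_cnj: "principal_stem x y q\<^sub>0 m a b (cnj w) = cnj (principal_stem x y q\<^sub>0 m a b w)"
  by (simp add: principal_stem_def)

lemma principal_stem_analytic:
  assumes "w \<noteq> Complex x y" "w \<noteq> Complex x (- y)"
  shows "principal_stem x y q\<^sub>0 m a b analytic_on {w}"
proof -
  have "principal_stem x y q\<^sub>0 m a b = (\<lambda>w. \<Sum>n=1..m.
     (of_real (inner (a (2 * n) - q\<^sub>0 * a (2 * n + 1)) b) + w * of_real (inner (a (2 * n + 1)) b)) /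
     ((w - of_real x)\<^sup>2 + (of_real y)\<^sup>2) ^ n)"
    by (rule ext) (rule principal_stem_def)
  moreover have "(w - of_real x)\<^sup>2 + (of_real y)\<^sup>2 \<noteq> 0"
    using assms by (simp add: sphere_poly_factor)
  ultimately show ?thesis by (auto intro!: analytic_intros)
qed

lemma principal_stem_meromorphic: "principal_stem x y q\<^sub>0 m a b meromorphic_on A"
proof -
  have "principal_stem x y q\<^sub>0 m a b = (\<lambda>w. \<Sum>n=1..m.
     (of_real (inner (a (2 * n) - q\<^sub>0 * a (2 * n + 1)) b) + w * of_real (inner (a (2 * n + 1)) b)) /
     ((w - of_real x)\<^sup>2 + (of_real y)\<^sup>2) ^ n)"
    by (rule ext) (rule principal_stem_def)
  then show ?thesis by (auto intro!: meromorphic_intros)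
qed

text \<open>The factor \<open>g\<close> is induced by \<open>H\<close>, which is
  \<open>s ^ m\<close> times \<open>G\<close> with the singularity at this sphere filled in.
  Subtracting the prescribed stem from \<open>G\<close> leaves an analytic \<open>K\<close>; in
  \<open>H\<close> it is multiplied by \<open>s ^ m\<close> and hence contributes only from the
  power \<open>m\<close> on, so the first \<open>m\<close> pairs of coefficients are the prescribed
  ones.\<close>

lemma has_principal_part_stem_fun:
  fixes x y :: real
  assumes U: "open U" "connected U" "\<forall>z\<in>U. cnj z \<in> U" "of_real r \<in> U"
    and Z: "Z \<subseteq> U" "Z sparse_in U" "\<forall>z\<in>Z. cnj z \<in> Z"
    and G: "intrinsic G" "\<And>b. b \<in> Basis \<Longrightarrow> G b holomorphic_on U - Z"
      "\<And>b z. b \<in> Basis \<Longrightarrow> z \<in> Z \<Longrightarrow> G b meromorphic_on {z}"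
    and xy: "Complex x y \<in> Z"
    and near: "\<And>b z. b \<in> Basis \<Longrightarrow> z \<in> {Complex x y, Complex x (- y)} \<Longrightarrow>
      \<exists>h. h analytic_on {z} \<and> (\<forall>\<^sub>F w in at z. G b w = principal_stem x y q\<^sub>0 m a b w + h w)"
  shows "has_principal_part (circularization U) (circularization (U - Z)) (stem_fun G) x y q\<^sub>0
    (\<lambda>q. \<Sum>n=1..m. ((q - of_real x)\<^sup>2 + (of_real y)\<^sup>2) powi (- int n) *
                      (a (2 * n) + (q - q\<^sub>0) * a (2 * n + 1)))"
proof -
  define s where "s = (\<lambda>w. (w - of_real x)\<^sup>2 + (of_real y :: complex)\<^sup>2)"
  define Q where "Q = {Complex x y, Complex x (- y)}"
  \<comment> \<open>Only the poles of the sphere under consideration are filled in; \<open>g\<close>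
    keeps all others.\<close>
  define Z' where "Z' = Z - Q"
  have s0: "s w = 0 \<longleftrightarrow> w \<in> Q" for w by (simp add: s_def sphere_poly_factor Q_def)
  have s_cnj: "s (cnj w) = cnj (s w)" for w by (simp add: s_def)
  have Q_cnj: "cnj w \<in> Q \<longleftrightarrow> w \<in> Q" for w by (simp flip: s0 add: s_cnj)
  have "cnj (Complex x y) \<in> Z" using xy Z(3) by blast
  then have QZ: "Q \<subseteq> Z" using xy by (simp add: Q_def complex_cnj)
  have Z': "Z' \<subseteq> U" "Z' sparse_in U" "\<forall>z\<in>Z'. cnj z \<in> Z'"
    using Z sparse_in_subset2[OF Z(2), of Z'] Q_cnj by (auto simp: Z'_def)
  have oUZ: "open (U - Z)" using U Z by (intro open_diff_sparse_pts)
  let ?P = "principal_stem x y q\<^sub>0 m a"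

  have "\<exists>h. \<forall>b\<in>Basis. \<forall>z\<in>Q. h b z analytic_on {z} \<and> (\<forall>\<^sub>F w in at z. G b w = ?P b w + h b z w)"
    using near unfolding Q_def[symmetric] by metis
  then obtain h where h: "\<And>b z. b \<in> Basis \<Longrightarrow> z \<in> Q \<Longrightarrow> h b z analytic_on {z}"
      "\<And>b z. b \<in> Basis \<Longrightarrow> z \<in> Q \<Longrightarrow> \<forall>\<^sub>F w in at z. G b w = ?P b w + h b z w"
    by metis
  \<comment> \<open>\<open>K0\<close> fills the removable singularities with the values of the
    analytic remainders. Averaging with the reflection gives the conjugation symmetry on
    \<open>Q\<close> directly and changes nothing off \<open>Q\<close>.\<close>
  define K0 where "K0 = (\<lambda>b w. if w \<in> Q then h b w w else G b w - ?P b w)"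
  define K1 where "K1 = (\<lambda>b. cnj \<circ> K0 b \<circ> cnj)"
  define K where "K = (\<lambda>b w. (K0 b w + K1 b w) / 2)"
  have K_off: "K b w = G b w - ?P b w" if "w \<notin> Q" for b w
    using that Q_cnj[of w] G(1) by (simp add: K_def K1_def K0_def principal_stem_cnj intrinsic_def)
  have K_cnj: "K b (cnj w) = cnj (K b w)" for b w by (simp add: K_def K1_def add.commute)
  have K0_an: "K0 b analytic_on {z}" if b: "b \<in> Basis" and z: "z \<in> U - Z'" for b z
  proof (cases "z \<in> Q")
    case True
    have "\<forall>\<^sub>F w in at z. w \<notin> Q"
      using islimpt_finite[of Q z] by (simp add: Q_def islimpt_iff_eventually)
    with h(2)[OF b True] have "\<forall>\<^sub>F w in at z. K0 b w = h b z w"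
      by eventually_elim (simp add: K0_def)
    moreover have "K0 b z = h b z z" using True by (simp add: K0_def)
    ultimately have "\<forall>\<^sub>F w in nhds z. K0 b w = h b z w"
      by (simp add: eventually_nhds_conv_at)
    then show ?thesis using h(1)[OF b True] by (simp add: analytic_at_cong)
  next
    case False
    then have zZ: "z \<in> U - Z" using z by (auto simp: Z'_def)
    have "G b analytic_on {z}" using G(2)[OF b] oUZ zZ by (metis analytic_at)
    moreover have "?P b analytic_on {z}"
      using False by (intro principal_stem_analytic) (auto simp: Q_def)
    ultimately have "(\<lambda>w. G b w - ?P b w) analytic_on {z}" by (intro analytic_intros)
    moreover have "\<forall>\<^sub>F w in nhds z. w \<in> U - Z" using oUZ zZ by (rule eventually_nhds_in_open)
    then have "\<forall>\<^sub>F w in nhds z. K0 b w = G b w - ?P b w"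
      by eventually_elim (use QZ in \<open>auto simp: K0_def\<close>)
    ultimately show ?thesis by (simp add: analytic_at_cong)
  qed
  have K_an: "K b analytic_on {z}" if b: "b \<in> Basis" and z: "z \<in> U - Z'" for b z
  proof -
    have "cnj z \<in> U - Z'" using z U(3) Z'(3) by (metis Diff_iff complex_cnj_cnj)
    then have "K1 b analytic_on {z}" unfolding K1_def using b by (intro analytic_cnj_conj K0_an)
    then show ?thesis unfolding K_def using K0_an[OF b z] by (intro analytic_intros) auto
  qed

  define p where "p = (\<lambda>b w. \<Sum>n=1..m. s w ^ (m - n) *
     (of_real (inner (a (2 * n) - q\<^sub>0 * a (2 * n + 1)) b) + w * of_real (inner (a (2 * n + 1)) b)))"
  \<comment> \<open>\<open>p\<close> is the prescribed stem multiplied by \<open>s ^ m\<close> with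
    the denominators cleared, so \<open>H\<close> has meaningful values also on \<open>Q\<close>,
    where the product of \<open>s ^ m\<close> and \<open>G\<close> need not.\<close>
  define H where "H = (\<lambda>b w. p b w + s w ^ m * K b w)"
  have H_off: "H b w = s w ^ m * G b w" if "w \<notin> Q" for b w
  proof -
    have "?P b w = (\<Sum>n=1..m. (of_real (inner (a (2 * n) - q\<^sub>0 * a (2 * n + 1)) b) +
        w * of_real (inner (a (2 * n + 1)) b)) / s w ^ n)"
      by (simp add: principal_stem_def s_def)
    moreover have "s w \<noteq> 0" using that s0 by simp
    ultimately have "p b w = s w ^ m * ?P b w"
      by (simp only: p_def sum_distrib_left, intro sum.cong refl) (simp add: power_diff)
    then show ?thesis by (simp add: H_def K_off[OF that] algebra_simps)
  qed
  have H_int: "intrinsic H"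
    by (simp add: intrinsic_def H_def p_def K_cnj s_cnj)
  have s_an: "s analytic_on A" for A unfolding s_def by (intro analytic_intros)
  have "H b analytic_on {z}" if "b \<in> Basis" "z \<in> U - Z'" for b z
    unfolding H_def p_def using s_an K_an[OF that] by (intro analytic_intros)
  then have "H b analytic_on U - Z'" if "b \<in> Basis" for b
    using that by (subst analytic_on_analytic_at) blast
  then have H_hol: "H b holomorphic_on U - Z'" if "b \<in> Basis" for b
    using that by (intro analytic_imp_holomorphic)
  have H_mero: "H b meromorphic_on {z}" if b: "b \<in> Basis" and z: "z \<in> Z'" for b z
  proof -
    have "(\<lambda>w. s w ^ m * G b w) meromorphic_on {z}"
      using G(3)[OF b, of z] z analytic_on_imp_meromorphic_on[OF s_an]
      by (intro meromorphic_intros) (auto simp: Z'_def)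
    moreover have "\<forall>\<^sub>F w in at z. w \<notin> Q"
      using islimpt_finite[of Q z] by (simp add: Q_def islimpt_iff_eventually)
    then have "\<forall>\<^sub>F w in at z. H b w = s w ^ m * G b w"
      by eventually_elim (rule H_off)
    ultimately show ?thesis by (subst meromorphic_on_cong[of "{z}" "H b"]) auto
  qed
  have semi: "semiregular_on (circularization U) (circularization (U - Z')) (stem_fun H)"
    using U Z' H_int H_hol H_mero by (rule semiregular_stem_fun)

  obtain r1 where r1: "r1 > 0" "ball (Complex x y) r1 - {Complex x y} \<subseteq> U - Z"
    using sparse_punctured_ball[OF U(1) Z(2), of "Complex x y"] xy Z(1) by blast
  obtain r2 where r2: "r2 > 0" "ball (Complex x (- y)) r2 - {Complex x (- y)} \<subseteq> U - Z"
    using sparse_punctured_ball[OF U(1) Z(2), of "Complex x (- y)"] QZ Z(1) by (auto simp: Q_def)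
  \<comment> \<open>\<open>s\<close> is the product of the differences to the two conjugate points,
    so \<open>norm (s w) < R\<^sup>2\<close> puts \<open>w\<close> within \<open>R\<close> of one of
    them, inside a disc free of other poles. The bound by \<open>\<bar>y\<bar>\<close> is what the
    power series in \<open>s\<close> requires.\<close>
  define R where "R = (if y = 0 then min r1 r2 else min (min r1 r2) \<bar>y\<bar>)"
  have R: "R > 0" "y \<noteq> 0 \<Longrightarrow> R \<le> \<bar>y\<bar>" "R \<le> r1" "R \<le> r2"
    using r1 r2 by (auto simp: R_def)
  define V where "V = {w. norm (s w) < R\<^sup>2}"
  have V: "V \<subseteq> U - Z'"
  proof
    fix w assume "w \<in> V"
    then have "norm (w - Complex x y) * norm (w - Complex x (- y)) < R * R"
      unfolding V_def s_def sphere_poly_factor by (simp add: norm_mult power2_eq_square)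
    then have "norm (w - Complex x y) < R \<or> norm (w - Complex x (- y)) < R"
      using R(1) by (meson linorder_not_less mult_mono norm_ge_zero order_less_imp_le)
    then have "w \<in> ball (Complex x y) r1 \<or> w \<in> ball (Complex x (- y)) r2"
      using R by (auto simp: dist_norm norm_minus_commute)
    moreover have "Q \<subseteq> U - Z'" using QZ Z(1) by (auto simp: Z'_def)
    ultimately show "w \<in> U - Z'"
      using r1(2) r2(2) by (auto simp: Q_def Z'_def)
  qed

  have "\<exists>c d. \<forall>w\<in>V. (\<lambda>j. s w ^ j * (of_real (c j) + w * of_real (d j))) sums K b w"
    if b: "b \<in> Basis" for b
  proof -
    have "K b analytic_on U - Z'" using K_an[OF b] by (subst analytic_on_analytic_at) blast
    then have "K b holomorphic_on V" using V by (meson analytic_imp_holomorphic analytic_on_subset)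
    then have hol: "K b holomorphic_on {w. norm ((w - of_real x)\<^sup>2 + (of_real y)\<^sup>2) < R\<^sup>2}"
      by (simp add: V_def s_def)
    show ?thesis
    proof (rule spherical_power_series_real[OF R(1,2) hol K_cnj])
      fix c d assume *: "\<And>w. norm ((w - of_real x)\<^sup>2 + (of_real y)\<^sup>2) < R\<^sup>2 \<Longrightarrow>
        (\<lambda>j. ((w - of_real x)\<^sup>2 + (of_real y)\<^sup>2) ^ j * (of_real (c j) + w * of_real (d j))) sums K b w"
      show ?thesis
        by (intro exI[of _ c] exI[of _ d]) (simp add: V_def s_def *)
    qed
  qed
  then obtain c d where cd: "\<And>b w. b \<in> Basis \<Longrightarrow> w \<in> V \<Longrightarrow>
      (\<lambda>j. s w ^ j * (of_real (c b j) + w * of_real (d b j))) sums K b w"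
    by metis
  define C where "C = (\<lambda>j. \<Sum>b\<in>Basis. c b j *\<^sub>R (b :: quat))"
  define D where "D = (\<lambda>j. \<Sum>b\<in>Basis. d b j *\<^sub>R (b :: quat))"
  have CD: "inner (C j) b = c b j" "inner (D j) b = d b j" if "b \<in> Basis" for b j
    using that by (simp_all add: C_def D_def)

  \<comment> \<open>The exponent \<open>- n\<close> of the principal part becomes the index
    \<open>m - n\<close>, so the prescribed coefficients appear in reverse order in the first
    \<open>m\<close> pairs. The later pairs come from \<open>K\<close>, with
    \<open>C + q * D\<close> rewritten as
    \<open>(C + q\<^sub>0 * D) + (q - q\<^sub>0) * D\<close>.\<close>
  define B where "B = (\<lambda>l. let j = l div 2 in
     if j < m then a (2 * (m - j) + l mod 2)
     else if even l then C (j - m) + q\<^sub>0 * D (j - m) else D (j - m))"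
  have B_low: "B (2 * (m - n)) = a (2 * n)" "B (2 * (m - n) + 1) = a (2 * n + 1)" if "n \<in> {1..m}" for n
    using that by (simp_all add: B_def)
  have B_high: "B (2 * (j + m)) = C j + q\<^sub>0 * D j" "B (2 * (j + m) + 1) = D j" for j
    by (simp_all add: B_def)

  have expansion: "spherical_expansion (stem_fun H) x y q\<^sub>0 R B"
    unfolding spherical_expansion_def
  proof
    fix q assume q: "q \<in> sphere_nbhd x y R"
    obtain J where J: "J \<in> imag_units" and qJ: "q = slice_embed J (slice_coord q)"
      using ex_slice_embed by blast
    define w where "w = slice_coord q"
    have qw: "q = slice_embed J w" using qJ by (simp add: w_def)
    have w: "w \<in> V" using q by (simp add: sphere_nbhd_eq_circularization circularization_def V_def s_def w_def)
    have sq: "sphere_poly x y q = slice_embed J (s w)" by (simp add: qw sphere_poly_embed[OF J] s_def)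
    let ?T = "\<lambda>j. sphere_poly x y q ^ j * (B (2 * j) + (q - q\<^sub>0) * B (2 * j + 1))"
    have "stem_value J (\<lambda>b. p b w) = (\<Sum>n=1..m. slice_embed J (s w ^ (m - n)) *
        (a (2 * n) - q\<^sub>0 * a (2 * n + 1) + q * a (2 * n + 1)))"
      unfolding p_def stem_value_sum stem_value_comb[OF J] by (simp add: qw)
    also have "\<dots> = (\<Sum>n=1..m. ?T (m - n))"
    proof (intro sum.cong refl)
      fix n assume n: "n \<in> {1..m}"
      have "a (2 * n) - q\<^sub>0 * a (2 * n + 1) + q * a (2 * n + 1) =
          B (2 * (m - n)) + (q - q\<^sub>0) * B (2 * (m - n) + 1)"
        using B_low[OF n] by (simp only:) (simp add: algebra_simps)
      then show "slice_embed J (s w ^ (m - n)) *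
          (a (2 * n) - q\<^sub>0 * a (2 * n + 1) + q * a (2 * n + 1)) = ?T (m - n)"
        by (simp only: sq slice_embed_power[OF J])
    qed
    also have "\<dots> = (\<Sum>j<m. ?T j)"
      by (rule sum.reindex_bij_witness[of _ "\<lambda>j. m - j" "\<lambda>n. m - n"]) auto
    finally have low: "stem_value J (\<lambda>b. p b w) = (\<Sum>j<m. ?T j)" .
    have "(\<lambda>j. stem_value J (\<lambda>b. s w ^ m * (s w ^ j * (of_real (c b j) + w * of_real (d b j))))) sums
        stem_value J (\<lambda>b. s w ^ m * K b w)"
      by (intro sums_stem_value sums_mult cd w)
    moreover have "stem_value J (\<lambda>b. s w ^ m * (s w ^ j * (of_real (c b j) + w * of_real (d b j)))) = ?T (j + m)" for j
    proof -
      have "stem_value J (\<lambda>b. s w ^ m * (s w ^ j * (of_real (c b j) + w * of_real (d b j)))) =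
          stem_value J (\<lambda>b. s w ^ (j + m) * (of_real (inner (C j) b) + w * of_real (inner (D j) b)))"
        unfolding stem_value_def by (intro sum.cong refl) (simp add: CD power_add mult_ac)
      also have "\<dots> = sphere_poly x y q ^ (j + m) * (C j + q * D j)"
        by (simp only: stem_value_comb[OF J] sq slice_embed_power[OF J] flip: qw)
      also have "C j + q * D j = B (2 * (j + m)) + (q - q\<^sub>0) * B (2 * (j + m) + 1)"
        unfolding B_high by (simp add: algebra_simps)
      finally show ?thesis .
    qed
    ultimately have "(\<lambda>j. ?T (j + m)) sums stem_value J (\<lambda>b. s w ^ m * K b w)" by simp
    then have "?T sums (stem_value J (\<lambda>b. s w ^ m * K b w) + (\<Sum>j<m. ?T j))"
      by (subst (asm) sums_iff_shift)
    moreover have "stem_fun H q = stem_value J (\<lambda>b. p b w) + stem_value J (\<lambda>b. s w ^ m * K b w)"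
      unfolding qw stem_fun_embed[OF H_int J] stem_value_add[symmetric] by (simp add: H_def)
    ultimately show "?T sums stem_fun H q" using low by (simp add: add.commute)
  qed

  have quotient: "stem_fun G q = sphere_poly x y q powi (- int m) * stem_fun H q"
    if q: "q \<notin> qsphere x y" for q
  proof -
    obtain J where J: "J \<in> imag_units" and qJ: "q = slice_embed J (slice_coord q)"
      using ex_slice_embed by blast
    define w where "w = slice_coord q"
    have qw: "q = slice_embed J w" using qJ by (simp add: w_def)
    have wQ: "w \<notin> Q" using q by (simp add: qsphere_eq_circularization circularization_def Q_def w_def)
    have sq: "sphere_poly x y q = slice_embed J (s w)" by (simp add: qw sphere_poly_embed[OF J] s_def)
    have "stem_fun H q = sphere_poly x y q ^ m * stem_fun G q"
      by (simp add: qw stem_fun_embed[OF H_int J] stem_fun_embed[OF G(1) J] H_off[OF wQ]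
          stem_value_mult[OF J] sphere_poly_embed[OF J] s_def slice_embed_power[OF J])
    moreover have "sphere_poly x y q \<noteq> 0" using wQ s0 by (simp add: sq slice_embed_eq_0_iff[OF J])
    ultimately show ?thesis by (simp add: power_int_minus flip: mult.assoc)
  qed
  show ?thesis
    unfolding has_principal_part_def
  proof (intro exI conjI allI ballI impI)
    show "semiregular_on (circularization U) (circularization (U - Z')) (stem_fun H)" by (rule semi)
    show "qsphere x y \<subseteq> circularization (U - Z')"
      unfolding qsphere_eq_circularization
      by (rule circularization_mono) (use QZ Z(1) in \<open>auto simp: Q_def Z'_def\<close>)
    show "stem_fun G q = sphere_poly x y q powi (- int m) * stem_fun H q"
      if "q \<in> circularization (U - Z) \<inter> circularization (U - Z') - qsphere x y" for q
      using that by (intro quotient) auto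
    show "R > 0" by (rule R)
    show "sphere_nbhd x y R \<subseteq> circularization (U - Z')"
      using V unfolding sphere_nbhd_eq_circularization V_def s_def by (rule circularization_mono)
    show "spherical_expansion (stem_fun H) x y q\<^sub>0 R B" by (rule expansion)
    show "(\<Sum>n=1..m. ((q - of_real x)\<^sup>2 + (of_real y)\<^sup>2) powi (- int n) *
                      (a (2 * n) + (q - q\<^sub>0) * a (2 * n + 1))) =
        (\<Sum>n=1..m. sphere_poly x y q powi (- int n) *
                    (B (2 * (m - n)) + (q - q\<^sub>0) * B (2 * (m - n) + 1)))" for q
      by (intro sum.cong refl) (simp only: B_low sphere_poly_def)
  qed
qed

section \<open>The main theorem\<close>

theorem theorem2:
  fixes \<Omega> :: "quat set" and A :: "'a set" and x y :: "'a \<Rightarrow> real"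
    and I q\<^sub>0 :: "'a \<Rightarrow> quat" and m :: "'a \<Rightarrow> nat" and a :: "'a \<Rightarrow> nat \<Rightarrow> quat"
  assumes "symmetric_slice_domain \<Omega>"
    and "closed_discrete_spheres \<Omega> A x y"
    and "\<And>\<alpha>. \<alpha> \<in> A \<Longrightarrow> I \<alpha> \<in> imag_units"
    and "\<And>\<alpha>. \<alpha> \<in> A \<Longrightarrow> q\<^sub>0 \<alpha> = of_real (x \<alpha>) + of_real (y \<alpha>) * I \<alpha>"
  shows "\<exists>D f. semiregular_on \<Omega> D f \<and>
           (\<forall>\<alpha>\<in>A. has_principal_part \<Omega> D f (x \<alpha>) (y \<alpha>) (q\<^sub>0 \<alpha>)
              (\<lambda>q. \<Sum>n=1..m \<alpha>. ((q - of_real (x \<alpha>))\<^sup>2 + (of_real (y \<alpha>))\<^sup>2) powi (- int n) *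
                      (a \<alpha> (2 * n) + (q - q\<^sub>0 \<alpha>) * a \<alpha> (2 * n + 1)))) \<and>
           (\<forall>p\<in>\<Omega>. qpole D f p \<longrightarrow> (\<exists>\<alpha>\<in>A. p \<in> qsphere (x \<alpha>) (y \<alpha>)))"
proof -
  obtain U r where \<Omega>: "\<Omega> = circularization U" and U: "open U" "connected U"
      and U_sym: "\<forall>z\<in>U. cnj z \<in> U" and r: "of_real r \<in> U"
    using symmetric_slice_domainE[OF assms(1)] .
  have sub: "\<And>\<alpha>. \<alpha> \<in> A \<Longrightarrow> qsphere (x \<alpha>) (y \<alpha>) \<subseteq> \<Omega>"
    and inj: "inj_on (\<lambda>\<alpha>. qsphere (x \<alpha>) (y \<alpha>)) A"
    and fin: "\<And>K. compact K \<Longrightarrow> K \<subseteq> \<Omega> \<Longrightarrow> finite {\<alpha>\<in>A. qsphere (x \<alpha>) (y \<alpha>) \<inter> K \<noteq> {}}"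
    using assms(2) unfolding closed_discrete_spheres_def by auto
  define Q where "Q = (\<lambda>\<alpha>. {Complex (x \<alpha>) (y \<alpha>), Complex (x \<alpha>) (- y \<alpha>)})"
  define Z where "Z = (\<Union>\<alpha>\<in>A. Q \<alpha>)"
  have sphere: "qsphere (x \<alpha>) (y \<alpha>) = circularization (Q \<alpha>)" for \<alpha>
    by (simp add: qsphere_eq_circularization Q_def)
  have Q_cnj: "\<forall>z\<in>Q \<alpha>. cnj z \<in> Q \<alpha>" for \<alpha>
    by (simp add: Q_def complex_cnj)
  have Q_eq: "Q \<alpha> = {z, cnj z}" if "z \<in> Q \<alpha>" for z \<alpha>
    using that by (auto simp: Q_def complex_cnj)
  \<comment> \<open>A point together with its conjugate determines the sphere, and distinct indices
    have distinct spheres.\<close>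
  have unique: "\<alpha> = \<beta>" if "\<alpha> \<in> A" "\<beta> \<in> A" "z \<in> Q \<alpha>" "z \<in> Q \<beta>" for \<alpha> \<beta> z
  proof -
    have "qsphere (x \<alpha>) (y \<alpha>) = qsphere (x \<beta>) (y \<beta>)"
      unfolding sphere Q_eq[OF that(3)] Q_eq[OF that(4)] ..
    then show ?thesis using inj that(1,2) by (auto dest: inj_onD)
  qed
  obtain J where J: "J \<in> imag_units" using imag_units_nonempty by blast
  have QU: "Q \<alpha> \<subseteq> U" if "\<alpha> \<in> A" for \<alpha>
  proof
    fix z assume "z \<in> Q \<alpha>"
    then have "slice_embed J z \<in> qsphere (x \<alpha>) (y \<alpha>)"
      unfolding sphere using slice_embed_in_circularization[OF J Q_cnj] by blast
    then have "slice_embed J z \<in> \<Omega>" using sub[OF that] by blast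
    then show "z \<in> U" unfolding \<Omega> using slice_embed_in_circularization[OF J U_sym] by blast
  qed
  then have ZU: "Z \<subseteq> U" by (auto simp: Z_def)
  have Z_sym: "\<forall>z\<in>Z. cnj z \<in> Z" using Q_cnj by (auto simp: Z_def)
  \<comment> \<open>A small closed disc, embedded in a single slice, is a compact subset of
    \<open>\<Omega>\<close>; it meets finitely many spheres, each of which contributes at most two
    points to \<open>Z\<close>.\<close>
  have Z_sparse: "Z sparse_in U"
    unfolding sparse_in_open[OF U(1)]
  proof
    fix u assume "u \<in> U"
    then obtain e where e: "e > 0" "cball u e \<subseteq> U" using U(1) open_contains_cball by blast
    define K where "K = slice_embed J ` cball u e"
    have "compact K"
      unfolding K_def by (intro compact_continuous_image linear_continuous_on bounded_linear_slice_embed) auto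
    moreover have "K \<subseteq> \<Omega>"
      using e(2) slice_embed_in_circularization[OF J U_sym] by (auto simp: K_def \<Omega>)
    ultimately have fK: "finite {\<alpha>\<in>A. qsphere (x \<alpha>) (y \<alpha>) \<inter> K \<noteq> {}}" by (rule fin)
    have "Z \<inter> ball u e \<subseteq> (\<Union>\<alpha>\<in>{\<alpha>\<in>A. qsphere (x \<alpha>) (y \<alpha>) \<inter> K \<noteq> {}}. Q \<alpha>)"
    proof
      fix z assume z: "z \<in> Z \<inter> ball u e"
      then obtain \<alpha> where \<alpha>: "\<alpha> \<in> A" "z \<in> Q \<alpha>" by (auto simp: Z_def)
      then have "slice_embed J z \<in> qsphere (x \<alpha>) (y \<alpha>)"
        unfolding sphere using slice_embed_in_circularization[OF J Q_cnj] by blast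
      moreover have "slice_embed J z \<in> K" using z by (auto simp: K_def)
      ultimately show "z \<in> (\<Union>\<alpha>\<in>{\<alpha>\<in>A. qsphere (x \<alpha>) (y \<alpha>) \<inter> K \<noteq> {}}. Q \<alpha>)"
        using \<alpha> by blast
    qed
    moreover have "finite (\<Union>\<alpha>\<in>{\<alpha>\<in>A. qsphere (x \<alpha>) (y \<alpha>) \<inter> K \<noteq> {}}. Q \<alpha>)"
      using fK by (auto simp: Q_def)
    ultimately have "finite (Z \<inter> ball u e)" by (rule finite_subset)
    then show "\<not> u islimpt Z" using e(1) by (auto simp: islimpt_eq_infinite_ball)
  qed
  define idx where "idx = (\<lambda>z. SOME \<alpha>. \<alpha> \<in> A \<and> z \<in> Q \<alpha>)"
  have idx: "idx z = \<alpha>" if "\<alpha> \<in> A" "z \<in> Q \<alpha>" for z \<alpha>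
    unfolding idx_def by (rule some_equality) (use that unique in blast)+
  define P where "P = (\<lambda>b \<alpha>. principal_stem (x \<alpha>) (y \<alpha>) (q\<^sub>0 \<alpha>) (m \<alpha>) (a \<alpha>) b)"
  \<comment> \<open>Mittag-Leffler is applied to each coordinate separately. Both conjugate points
    of a sphere carry the same real rational function, which is the symmetry required of the
    prescription.\<close>
  have "\<exists>F. F holomorphic_on U - Z \<and> (\<forall>z. F (cnj z) = cnj (F z)) \<and>
    (\<forall>z\<in>Z. \<exists>h. h analytic_on {z} \<and> (\<forall>\<^sub>F w in at z. F w = P b (idx z) w + h w))" for b
  proof -
    have "P b (idx (cnj z)) (cnj w) = cnj (P b (idx z) w)" if z: "z \<in> Z" for z w
    proof -
      obtain \<alpha> where \<alpha>: "\<alpha> \<in> A" "z \<in> Q \<alpha>" using z by (auto simp: Z_def)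
      then have "idx (cnj z) = idx z" using idx Q_cnj by metis
      then show ?thesis by (simp add: P_def principal_stem_cnj)
    qed
    moreover have "P b (idx z) meromorphic_on {z}" for z
      unfolding P_def by (rule principal_stem_meromorphic)
    ultimately show ?thesis
      using mittag_leffler_symmetric[OF U(1) ZU Z_sparse bspec[OF Z_sym] bspec[OF U_sym], of "\<lambda>z. P b (idx z)"]
      by metis
  qed
  then obtain G where G: "\<And>b. G b holomorphic_on U - Z" "\<And>b z. G b (cnj z) = cnj (G b z)"
    "\<And>b z. z \<in> Z \<Longrightarrow> \<exists>h. h analytic_on {z} \<and> (\<forall>\<^sub>F w in at z. G b w = P b (idx z) w + h w)"
    by metis
  have G_int: "intrinsic G" using G(2) by (simp add: intrinsic_def)
  have G_mero: "G b meromorphic_on {z}" if "z \<in> Z" for b z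
  proof -
    obtain h where h: "h analytic_on {z}" "\<forall>\<^sub>F w in at z. G b w = P b (idx z) w + h w"
      using G(3)[OF \<open>z \<in> Z\<close>] by blast
    have "(\<lambda>w. P b (idx z) w + h w) meromorphic_on {z}"
      unfolding P_def by (intro meromorphic_intros principal_stem_meromorphic analytic_on_imp_meromorphic_on h)
    then show ?thesis using h(2) by (subst meromorphic_on_cong[of "{z}" "G b"]) auto
  qed
  let ?D = "circularization (U - Z)"
  have semi: "semiregular_on \<Omega> ?D (stem_fun G)"
    unfolding \<Omega> by (rule semiregular_stem_fun[OF U U_sym r ZU Z_sparse Z_sym G_int G(1) G_mero])
  moreover have "has_principal_part \<Omega> ?D (stem_fun G) (x \<alpha>) (y \<alpha>) (q\<^sub>0 \<alpha>)
      (\<lambda>q. \<Sum>n=1..m \<alpha>. ((q - of_real (x \<alpha>))\<^sup>2 + (of_real (y \<alpha>))\<^sup>2) powi (- int n) *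
         (a \<alpha> (2 * n) + (q - q\<^sub>0 \<alpha>) * a \<alpha> (2 * n + 1)))" if \<alpha>: "\<alpha> \<in> A" for \<alpha>
    unfolding \<Omega>
  proof (rule has_principal_part_stem_fun[OF U U_sym r ZU Z_sparse Z_sym G_int G(1) G_mero])
    show "Complex (x \<alpha>) (y \<alpha>) \<in> Z" using \<alpha> by (auto simp: Z_def Q_def)
    fix b z assume "z \<in> {Complex (x \<alpha>) (y \<alpha>), Complex (x \<alpha>) (- y \<alpha>)}"
    then have "z \<in> Q \<alpha>" by (simp add: Q_def)
    then have "z \<in> Z" "idx z = \<alpha>" using \<alpha> idx by (auto simp: Z_def)
    then show "\<exists>h. h analytic_on {z} \<and>
        (\<forall>\<^sub>F w in at z. G b w = principal_stem (x \<alpha>) (y \<alpha>) (q\<^sub>0 \<alpha>) (m \<alpha>) (a \<alpha>) b w + h w)"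
      using G(3)[of z b] by (simp add: P_def)
  qed
  moreover have "\<exists>\<alpha>\<in>A. p \<in> qsphere (x \<alpha>) (y \<alpha>)" if p: "p \<in> \<Omega>" "qpole ?D (stem_fun G) p" for p
  proof -
    \<comment> \<open>The domain of regularity omits exactly the prescribed spheres, and none of its
      own points is a pole.\<close>
    have "open (U - Z)" using U(1) Z_sparse by (rule open_diff_sparse_pts)
    then have "p \<notin> ?D"
      using p(2) not_qpole_regular[OF open_circularization] semi by (auto simp: semiregular_on_def)
    then show ?thesis
      using p(1) by (auto simp: \<Omega> sphere Z_def circularization_def)
  qed
  ultimately show ?thesis by blast
qed

end
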